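(* Let $f(s)=\sum_{n} a_n e^{\lambda_n s}$, with $a_n\in\mathbb{C}$ and $\lambda_n\in\mathbb{R}$, be a series that converges uniformly in a half-plane $\Re(s)>b$, and suppose that its sum admits an analytic continuation to $\mathbb{C}$ as a nonconstant meromorphic function of finite order. Suppose that $f(s)$ tends to a nonzero (complex) limit as $\Re(s)\to+\infty$. Then either there is a constant $A>0$ such that $$\frac{n(r,0;f)+n(r,\infty;f)}{r}>A$$ for all sufficiently large $r$, or $$\int_{r_0}^{\infty}\frac{n(t,0;f)+n(t,\infty;f)}{t^3}\,dt=\infty$$ for some $r_0>0$.
   Context: Here $s=\sigma+it$ is a complex variable. For a function $f$ meromorphic in $\mathbb{C}$ and $a\in\mathbb{C}\cup\{\infty\}$, $n(r,a;f)$ denotes the number of solutions of $f(s)=a$ (poles when $a=\infty$) in the closed disc $|s|\le r$, counted with multiplicity. The order of a meromorphic function is its order in the sense of Nevanlinna theory. *)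

theory Defs
  imports "HOL-Complex_Analysis.Complex_Analysis"
begin

definition zero_count :: "(complex \<Rightarrow> complex) \<Rightarrow> real \<Rightarrow> real" where
  "zero_count f r = real (\<Sum>z\<in>{z. z \<in> cball 0 r \<and> 0 < zorder f z}. nat (zorder f z))"

definition pole_count :: "(complex \<Rightarrow> complex) \<Rightarrow> real \<Rightarrow> real" where
  "pole_count f r = real (\<Sum>z\<in>{z. z \<in> cball 0 r \<and> zorder f z < 0}. nat (- zorder f z))"

definition nev_m :: "(complex \<Rightarrow> complex) \<Rightarrow> real \<Rightarrow> real" where
  "nev_m f r = integral {0..2*pi} (\<lambda>\<theta>. max 0 (ln (norm (f (of_real r * cis \<theta>))))) / (2*pi)"

definition nev_N :: "(complex \<Rightarrow> complex) \<Rightarrow> real \<Rightarrow> real" where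
  "nev_N f r = integral {0..r} (\<lambda>t. (pole_count f t - pole_count f 0) / t)
               + pole_count f 0 * ln r"

definition nev_T :: "(complex \<Rightarrow> complex) \<Rightarrow> real \<Rightarrow> real" where
  "nev_T f r = nev_m f r + nev_N f r"

definition nev_order :: "(complex \<Rightarrow> complex) \<Rightarrow> ereal" where
  "nev_order f = Limsup at_top (\<lambda>r. ereal (ln (nev_T f r) / ln r))"

end

theory Submission
  imports Defs
begin

text \<open>
  Suppose that both alternatives fail. Then \<open>\<Sum> m\<^sub>\<rho> / |\<rho>|\<^sup>2\<close> converges over the zeros and poles \<open>\<rho>\<close>, counted with
  multiplicity \<open>m\<^sub>\<rho>\<close>, and \<open>n(r) \<le> A r\<close> for arbitrarily large \<open>r\<close>, however small \<open>A > 0\<close> is. A Poisson--Jensen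
  argument, using finite order, shows that \<open>(g'/g)' + \<Sum> \<plusminus>m\<^sub>\<rho> / (s - \<rho>)\<^sup>2\<close> is a polynomial on a right half-plane
  free of zeros and poles; as it tends to \<open>0\<close> along the positive reals, it vanishes. Since
  \<open>\<integral> dt / |x + it - \<rho>|\<^sup>2 \<le> \<pi>\<close> when \<open>Re \<rho> \<le> x - 1\<close>, the integral of \<open>|(g'/g)'|\<close> over a vertical segment of length
  \<open>T = r/4\<close> is at most \<open>\<pi> n(r) + o(T)\<close>, so its mean is arbitrarily small for suitable large \<open>T\<close>. But \<open>g\<close>,
  and with it \<open>(g'/g)'\<close>, is almost periodic on vertical lines, which forces \<open>(g'/g)' = 0\<close>. Then
  \<open>g'/g\<close> is constant, equal to its limit \<open>0\<close>, and \<open>g\<close> is constant.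
\<close>

section \<open>Poisson and Schwarz integral formulas on a circle\<close>

text \<open>The derivative of \<open>g'/g\<close> is used rather than \<open>g'/g\<close> itself
  because a finite counting integral gives absolute convergence of inverse squares only; a series
  for \<open>g'/g\<close> would need correction terms, and inverse first powers have no bounded
  integral over vertical lines. No canonical product is built: g is factored on one disc at a time,
  and the global expansion is a limit of identities on discs whose boundary circles avoid zeros and
  poles. Finite order enters as a bound \<open>r ^ N\<close> for the characteristic, which makes the
  remainder in each disc grow at most polynomially in the radius. The nonzero limit serves twice: it
  bounds |g| from below on a half-plane, so that the quotient \<open>g'/g\<close> inherits near
  periods from g, and it forces \<open>g'/g\<close> to tend to 0. Smallness of n(r)/r is available
  only for some arbitrarily large r. This is enough, since for an almost periodic function that is
  not identically zero the mean of its modulus over [0, T] stays above a positive constant for all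
  large T.\<close>

lemma circle_Cauchy_derivative:
  fixes P :: "complex \<Rightarrow> complex"
  assumes R: "0 < R" and P: "continuous_on (cball 0 R) P" "P holomorphic_on ball 0 R" and s: "norm s < R"
  shows "((\<lambda>\<theta>. P (of_real R * cis \<theta>) * (of_real R * cis \<theta>) / (of_real R * cis \<theta> - s) ^ Suc k)
    has_integral 2 * pi / fact k * (deriv ^^ k) P s) {0..2*pi}"
proof -
  have "((\<lambda>u. P u / (u - s) ^ Suc k) has_contour_integral (2 * pi * \<i>) / fact k * (deriv ^^ k) P s)
      (part_circlepath 0 R 0 (2*pi))"
    using Cauchy_has_contour_integral_higher_derivative_circlepath[OF P, of s k] s
    by (simp add: circlepath_def)
  then have "((\<lambda>t. P (0 + R * cis t) / (0 + R * cis t - s) ^ Suc k * R * \<i> * cis t)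
      has_integral (2 * pi * \<i>) / fact k * (deriv ^^ k) P s) {0..2*pi}"
    by (subst (asm) has_contour_integral_part_circlepath_iff) auto
  from has_integral_mult_right[OF this, of "-\<i>"]
  show ?thesis by (simp add: mult_ac)
qed

lemma circle_mean_value:
  fixes h :: "complex \<Rightarrow> complex"
  assumes "0 < R" "continuous_on (cball 0 R) h" "h holomorphic_on ball 0 R"
  shows "((\<lambda>\<theta>. h (of_real R * cis \<theta>)) has_integral 2 * pi * h 0) {0..2*pi}"
  using circle_Cauchy_derivative[OF assms, of 0 0] assms(1) by simp

text \<open>The reflection \<open>R^2 / cnj s\<close> of an interior point lies outside the closed
  disc. Hence the auxiliary functions \<open>h\<close> of the two formulas below are holomorphic in
  the disc and continuous up to the circle.\<close>

lemma reflected_nonzero: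
  fixes s w :: complex
  assumes "norm s < R" "norm w \<le> R"
  shows "of_real (R\<^sup>2) - cnj s * w \<noteq> 0"
proof
  assume "of_real (R\<^sup>2) - cnj s * w = 0"
  then have "norm (cnj s * w) = norm (complex_of_real (R\<^sup>2))" by simp
  then have "norm s * norm w = R\<^sup>2" by (simp add: norm_mult norm_power)
  moreover have "norm s * norm w \<le> norm s * R" using assms by (intro mult_left_mono) auto
  moreover have "norm s * R < R * R"
    using assms norm_ge_zero[of s] by (intro mult_strict_right_mono) linarith+
  ultimately show False by (simp add: power2_eq_square)
qed

text \<open>Cauchy's formula for the second derivative involves all of P on the circle. Adding the
  conjugate of a mean value that vanishes turns P into \<open>P + cnj P = 2 Re P\<close>: on the
  circle \<open>cnj (h w)\<close> is the same kernel times \<open>cnj (P w)\<close>, and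
  \<open>h 0 = 0\<close>.\<close>

lemma Schwarz_formula:
  fixes P :: "complex \<Rightarrow> complex"
  assumes R: "0 < R" and P: "continuous_on (cball 0 R) P" "P holomorphic_on ball 0 R" and s: "norm s < R"
  shows "((\<lambda>\<theta>. 2 * of_real (Re (P (of_real R * cis \<theta>))) * (of_real R * cis \<theta>) / (of_real R * cis \<theta> - s) ^ 3)
    has_integral pi * (deriv ^^ 2) P s) {0..2*pi}"
proof -
  define h where "h = (\<lambda>w. P w * of_real (R\<^sup>2) * w\<^sup>2 / (of_real (R\<^sup>2) - cnj s * w) ^ 3)"
  have I1: "((\<lambda>\<theta>. cnj (h (of_real R * cis \<theta>))) has_integral cnj (2 * pi * h 0)) {0..2*pi}"
    unfolding has_integral_cnj[unfolded o_def]
  proof (rule circle_mean_value[OF R])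
    show "continuous_on (cball 0 R) h" unfolding h_def
      by (intro continuous_intros P) (use reflected_nonzero[OF s] in auto)
    show "h holomorphic_on ball 0 R" unfolding h_def
      by (intro holomorphic_intros P) (use reflected_nonzero[OF s] in auto)
  qed
  have h0: "h 0 = 0" by (simp add: h_def)
  have I2: "((\<lambda>\<theta>. P (of_real R * cis \<theta>) * (of_real R * cis \<theta>) / (of_real R * cis \<theta> - s) ^ 3)
    has_integral pi * (deriv ^^ 2) P s) {0..2*pi}"
    using circle_Cauchy_derivative[OF assms, of 2] by (simp add: eval_nat_numeral)
  have "((\<lambda>\<theta>. P (of_real R * cis \<theta>) * (of_real R * cis \<theta>) / (of_real R * cis \<theta> - s) ^ 3
       + cnj (h (of_real R * cis \<theta>))) has_integral pi * (deriv ^^ 2) P s) {0..2*pi}"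
    using has_integral_add[OF I2 I1] by (simp only: h0 mult_zero_right complex_cnj_zero add_0_right)
  then show ?thesis
  proof (rule has_integral_eq[rotated])
    fix \<theta>
    define w where "w = of_real R * cis \<theta>"
    have nw: "norm w = R" using R by (simp add: w_def norm_mult)
    then have ww: "w * cnj w = of_real (R\<^sup>2)" by (simp flip: complex_norm_square)
    have nz: "w \<noteq> 0" using nw R by auto
    have "w - s \<noteq> 0" using nw s by auto
    then have d: "cnj w - cnj s \<noteq> 0" by (metis complex_cnj_diff complex_cnj_zero_iff)
    \<comment> \<open>On the circle \<open>R^2 = w * cnj w\<close>, so the reflected denominator is
      w times the conjugate of \<open>w - s\<close>.\<close>
    have "of_real (R\<^sup>2) - cnj s * w = w * (cnj w - cnj s)"
      using ww by (simp add: algebra_simps)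
    then have "h w = P w * (w * cnj w) * w\<^sup>2 / (w * (cnj w - cnj s)) ^ 3"
      unfolding h_def ww by simp
    also have "\<dots> = P w * cnj w / (cnj w - cnj s) ^ 3"
      using nz by (simp add: power_mult_distrib power2_eq_square power3_eq_cube)
    finally have "cnj (h w) = cnj (P w) * w / (w - s) ^ 3" by simp
    then have "P w * w / (w - s) ^ 3 + cnj (h w) = (P w + cnj (P w)) * w / (w - s) ^ 3"
      by (simp add: add_divide_distrib distrib_right)
    also have "P w + cnj (P w) = 2 * of_real (Re (P w))"
      by (simp add: complex_add_cnj)
    finally show "P (of_real R * cis \<theta>) * (of_real R * cis \<theta>) / (of_real R * cis \<theta> - s) ^ 3
        + cnj (h (of_real R * cis \<theta>))
      = 2 * of_real (Re (P (of_real R * cis \<theta>))) * (of_real R * cis \<theta>) / (of_real R * cis \<theta> - s) ^ 3"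
      unfolding w_def .
  qed
qed

text \<open>Again a function with \<open>h 0 = 0\<close> is added to Cauchy's formula, this time
  without conjugation. On the circle the two kernels add up to the Poisson kernel, which is real, so
  taking real parts leaves only Re P.\<close>

lemma Poisson_formula:
  fixes P :: "complex \<Rightarrow> complex"
  assumes R: "0 < R" and P: "continuous_on (cball 0 R) P" "P holomorphic_on ball 0 R" and c: "norm c < R"
  shows "((\<lambda>\<theta>. Re (P (of_real R * cis \<theta>)) * ((R\<^sup>2 - (norm c)\<^sup>2) / (norm (of_real R * cis \<theta> - c))\<^sup>2))
    has_integral 2 * pi * Re (P c)) {0..2*pi}"
proof -
  define h where "h = (\<lambda>w. P w * cnj c * w / (of_real (R\<^sup>2) - cnj c * w))"
  have I1: "((\<lambda>\<theta>. h (of_real R * cis \<theta>)) has_integral (2 * pi * h 0)) {0..2*pi}"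
  proof (rule circle_mean_value[OF R])
    show "continuous_on (cball 0 R) h" unfolding h_def
      by (intro continuous_intros P) (use reflected_nonzero[OF c] in auto)
    show "h holomorphic_on ball 0 R" unfolding h_def
      by (intro holomorphic_intros P) (use reflected_nonzero[OF c] in auto)
  qed
  have h0: "h 0 = 0" by (simp add: h_def)
  have I2: "((\<lambda>\<theta>. P (of_real R * cis \<theta>) * (of_real R * cis \<theta>) / (of_real R * cis \<theta> - c))
    has_integral 2 * pi * P c) {0..2*pi}"
    using circle_Cauchy_derivative[OF assms, of 0] by simp
  have "((\<lambda>\<theta>. P (of_real R * cis \<theta>) * (of_real R * cis \<theta>) / (of_real R * cis \<theta> - c)
       + h (of_real R * cis \<theta>)) has_integral 2 * pi * P c) {0..2*pi}"
    using has_integral_add[OF I2 I1] by (simp only: h0 mult_zero_right complex_cnj_zero add_0_right)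
  from has_integral_Re[OF this]
  have "((\<lambda>\<theta>. Re (P (of_real R * cis \<theta>) * (of_real R * cis \<theta>) / (of_real R * cis \<theta> - c)
       + h (of_real R * cis \<theta>))) has_integral 2 * pi * Re (P c)) {0..2*pi}" by simp
  then show ?thesis
  proof (rule has_integral_eq[rotated])
    fix \<theta>
    define w where "w = of_real R * cis \<theta>"
    have nw: "norm w = R" using R by (simp add: w_def norm_mult)
    then have ww: "w * cnj w = of_real (R\<^sup>2)" by (simp flip: complex_norm_square)
    have nz: "w \<noteq> 0" using nw R by auto
    have d1: "w - c \<noteq> 0" using nw c by auto
    then have d: "cnj w - cnj c \<noteq> 0" by (metis complex_cnj_diff complex_cnj_zero_iff)
    have e: "of_real (R\<^sup>2) - cnj c * w = w * (cnj w - cnj c)"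
      using ww by (simp add: algebra_simps)
    have "h w = P w * (cnj c / (cnj w - cnj c))"
      unfolding h_def e using nz by simp
    then have "P w * w / (w - c) + h w = P w * (w / (w - c) + cnj c / (cnj w - cnj c))"
      by (simp add: distrib_left)
    also have "w / (w - c) + cnj c / (cnj w - cnj c) = (w * cnj w - c * cnj c) / ((w - c) * cnj (w - c))"
      unfolding add_frac_eq[OF d1 d] complex_cnj_diff by (rule arg_cong2[where f = divide]) (simp_all add: algebra_simps)
    also have "\<dots> = of_real ((R\<^sup>2 - (norm c)\<^sup>2) / (norm (w - c))\<^sup>2)"
      unfolding ww of_real_divide of_real_diff complex_norm_square ..
    finally show "Re (P (of_real R * cis \<theta>) * (of_real R * cis \<theta>) / (of_real R * cis \<theta> - c)
         + h (of_real R * cis \<theta>))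
      = Re (P (of_real R * cis \<theta>)) * ((R\<^sup>2 - (norm c)\<^sup>2) / (norm (of_real R * cis \<theta> - c))\<^sup>2)"
      unfolding w_def[symmetric] by simp
  qed
qed

text \<open>A bound of Borel-Caratheodory type: Re P is controlled from above on the circle, in the
  mean, and from below at the single point c. Poisson's formula at c converts these into a bound for
  the mean of |Re P|, which Schwarz's formula turns into one for the second derivative.\<close>

lemma second_derivative_bound:
  fixes P :: "complex \<Rightarrow> complex"
  assumes R: "0 < R" and P: "continuous_on (cball 0 R) P" "P holomorphic_on ball 0 R"
    and s: "norm s \<le> R / 2" and c: "norm c \<le> R / 2"
    and A: "integral {0..2*pi} (\<lambda>\<theta>. max 0 (Re (P (of_real R * cis \<theta>)))) \<le> A"
  shows "norm ((deriv ^^ 2) P s) \<le> 96 / R\<^sup>2 * (A + max 0 (- Re (P c)))"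
proof -
  define u where "u = (\<lambda>\<theta>. Re (P (of_real R * cis \<theta>)))"
  define K where "K = (\<lambda>\<theta>. (R\<^sup>2 - (norm c)\<^sup>2) / (norm (of_real R * cis \<theta> - c))\<^sup>2)"
  define I where "I = {0..2*pi}"
  have nw: "norm (of_real R * cis \<theta>) = R" for \<theta> using R by (simp add: norm_mult)
  have ne: "of_real R * cis \<theta> \<noteq> c" for \<theta> using nw[of \<theta>] c R by auto
  have cu: "continuous_on I u"
    unfolding u_def by (intro continuous_intros continuous_on_compose2[OF P(1)]) (auto simp: nw)
  have cK: "continuous_on I K"
    unfolding K_def by (intro continuous_intros) (auto simp: ne)
  \<comment> \<open>Harnack's inequality: K lies between \<open>(R - |c|) / (R + |c|)\<close> and
    its reciprocal, and \<open>|c| \<le> R / 2\<close>.\<close>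
  have K: "1 / 3 \<le> K \<theta>" "K \<theta> \<le> 3" for \<theta>
  proof -
    have 1: "norm (of_real R * cis \<theta> - c) \<le> R + norm c"
      using norm_triangle_ineq4[of "of_real R * cis \<theta>" c] by (simp add: nw)
    have 2: "R - norm c \<le> norm (of_real R * cis \<theta> - c)"
      using norm_triangle_ineq2[of "of_real R * cis \<theta>" c] by (simp add: nw)
    have pos: "0 < R - norm c" using c R by auto
    have "R\<^sup>2 - (norm c)\<^sup>2 = (R - norm c) * (R + norm c)" by (simp add: power2_eq_square algebra_simps)
    have "(norm (of_real R * cis \<theta> - c))\<^sup>2 \<le> (R + norm c)\<^sup>2" using 1 by (intro power_mono) auto
    also have "\<dots> \<le> 3 * ((R - norm c) * (R + norm c))"
    proof -
      have "(R + norm c) * (R + norm c) \<le> (3 * (R - norm c)) * (R + norm c)"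
        using c R by (intro mult_right_mono) auto
      then show ?thesis by (simp only: power2_eq_square mult.assoc)
    qed
    finally have "(norm (of_real R * cis \<theta> - c))\<^sup>2 \<le> 3 * (R\<^sup>2 - (norm c)\<^sup>2)"
      by (simp add: power2_eq_square algebra_simps)
    then show "1 / 3 \<le> K \<theta>" unfolding K_def using ne[of \<theta>] by (simp add: field_simps)
    have "(R - norm c) * (R + norm c) \<le> (R - norm c) * (3 * (R - norm c))"
      using c R by (intro mult_left_mono) auto
    also have "\<dots> = 3 * (R - norm c)\<^sup>2" by (simp add: power2_eq_square)
    also have "\<dots> \<le> 3 * (norm (of_real R * cis \<theta> - c))\<^sup>2"
      using 2 pos by (intro mult_left_mono power_mono) auto
    finally have "R\<^sup>2 - (norm c)\<^sup>2 \<le> 3 * (norm (of_real R * cis \<theta> - c))\<^sup>2"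
      by (simp add: power2_eq_square algebra_simps)
    then show "K \<theta> \<le> 3" unfolding K_def using ne[of \<theta>] by (simp add: field_simps)
  qed
  have cR: "norm c < R" using c R by auto
  have Poi: "((\<lambda>\<theta>. u \<theta> * K \<theta>) has_integral 2 * pi * Re (P c)) I"
    using Poisson_formula[OF R P cR] by (simp add: u_def K_def I_def)
  have int_abs: "(\<lambda>\<theta>. \<bar>u \<theta>\<bar>) integrable_on I" "(\<lambda>\<theta>. max 0 (u \<theta>)) integrable_on I"
    unfolding I_def by (rule integrable_continuous_real; intro continuous_intros cu[unfolded I_def])+
  \<comment> \<open>Where u is negative, \<open>K \<ge> 1/3\<close> makes \<open>-3 u K\<close>
    dominate |u|; where u is nonnegative, \<open>K \<le> 3\<close> costs at most 9 u, which 18 u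
    absorbs. The integral of \<open>u K\<close> is known exactly, so the negative part needs no
    separate bound.\<close>
  have "integral I (\<lambda>\<theta>. \<bar>u \<theta>\<bar>) \<le> integral I (\<lambda>\<theta>. 18 * max 0 (u \<theta>) - 3 * (u \<theta> * K \<theta>))"
  proof (rule integral_le[OF int_abs(1)])
    show "(\<lambda>\<theta>. 18 * max 0 (u \<theta>) - 3 * (u \<theta> * K \<theta>)) integrable_on I"
      unfolding I_def by (rule integrable_continuous_real) (intro continuous_intros cu[unfolded I_def] cK[unfolded I_def])
    fix \<theta>
    show "\<bar>u \<theta>\<bar> \<le> 18 * max 0 (u \<theta>) - 3 * (u \<theta> * K \<theta>)"
    proof (cases "0 \<le> u \<theta>")
      case True
      then have "u \<theta> * K \<theta> \<le> u \<theta> * 3" using K by (intro mult_left_mono) auto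
      then show ?thesis using True by auto
    next
      case False
      then have "u \<theta> * K \<theta> \<le> u \<theta> * (1/3)" using K by (intro mult_left_mono_neg) auto
      then show ?thesis using False by auto
    qed
  qed
  also have "\<dots> = 18 * integral I (\<lambda>\<theta>. max 0 (u \<theta>)) - 3 * (2 * pi * Re (P c))"
    using has_integral_diff[OF has_integral_mult_right[OF integrable_integral[OF int_abs(2)], of 18]
        has_integral_mult_right[OF Poi, of 3]] by (rule integral_unique)
  also have "\<dots> \<le> 18 * A + 6 * pi * max 0 (- Re (P c))"
  proof -
    have "pi * (- Re (P c)) \<le> pi * max 0 (- Re (P c))" by (intro mult_left_mono) auto
    then show ?thesis using A by (simp add: u_def I_def)
  qed
  finally have abs: "integral I (\<lambda>\<theta>. \<bar>u \<theta>\<bar>) \<le> 18 * A + 6 * pi * max 0 (- Re (P c))" .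
  have sR: "norm s < R" using s R by auto
  have Sch: "((\<lambda>\<theta>. 2 * of_real (u \<theta>) * (of_real R * cis \<theta>) / (of_real R * cis \<theta> - s) ^ 3)
    has_integral pi * (deriv ^^ 2) P s) I"
    using Schwarz_formula[OF R P sR] by (simp add: u_def I_def)
  \<comment> \<open>The points of the circle have distance at least R/2 from s, and
    \<open>2 R / (R/2)^3 = 16 / R^2\<close>.\<close>
  have "norm (pi * (deriv ^^ 2) P s) \<le> integral I (\<lambda>\<theta>. 16 / R\<^sup>2 * \<bar>u \<theta>\<bar>)"
    unfolding integral_unique[OF Sch, symmetric]
  proof (rule integral_norm_bound_integral)
    show "(\<lambda>\<theta>. 2 * of_real (u \<theta>) * (of_real R * cis \<theta>) / (of_real R * cis \<theta> - s) ^ 3) integrable_on I"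
      using Sch by (rule has_integral_integrable)
    show "(\<lambda>\<theta>. 16 / R\<^sup>2 * \<bar>u \<theta>\<bar>) integrable_on I"
      unfolding I_def by (rule integrable_continuous_real) (intro continuous_intros cu[unfolded I_def])
    fix \<theta>
    have "R / 2 \<le> norm (of_real R * cis \<theta> - s)"
      using norm_triangle_ineq2[of "of_real R * cis \<theta>" s] s by (simp add: nw)
    then have "(R / 2) ^ 3 \<le> norm (of_real R * cis \<theta> - s) ^ 3" using R by (intro power_mono) auto
    then have "norm (2 * of_real (u \<theta>) * (of_real R * cis \<theta>) / (of_real R * cis \<theta> - s) ^ 3)
       \<le> 2 * \<bar>u \<theta>\<bar> * R / (R / 2) ^ 3"
    proof -
      have "norm (2 * of_real (u \<theta>) * (of_real R * cis \<theta>) / (of_real R * cis \<theta> - s) ^ 3)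
         = 2 * \<bar>u \<theta>\<bar> * R / norm (of_real R * cis \<theta> - s) ^ 3"
        unfolding norm_divide norm_power using R by (simp add: norm_mult)
      also have "\<dots> \<le> 2 * \<bar>u \<theta>\<bar> * R / (R / 2) ^ 3"
      proof (rule divide_left_mono)
        show "0 < norm (of_real R * cis \<theta> - s) ^ 3 * (R / 2) ^ 3"
          using R \<open>R / 2 \<le> norm (of_real R * cis \<theta> - s)\<close> by (intro mult_pos_pos zero_less_power) linarith+
      qed (use R \<open>(R / 2) ^ 3 \<le> norm (of_real R * cis \<theta> - s) ^ 3\<close> in auto)
      finally show ?thesis .
    qed
    also have "\<dots> = 16 / R\<^sup>2 * \<bar>u \<theta>\<bar>" using R by (simp add: power2_eq_square power3_eq_cube)
    finally show "norm (2 * of_real (u \<theta>) * (of_real R * cis \<theta>) / (of_real R * cis \<theta> - s) ^ 3)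
       \<le> 16 / R\<^sup>2 * \<bar>u \<theta>\<bar>" .
  qed
  also have "\<dots> = 16 / R\<^sup>2 * integral I (\<lambda>\<theta>. \<bar>u \<theta>\<bar>)" by simp
  also have "\<dots> \<le> 16 / R\<^sup>2 * (18 * A + 6 * pi * max 0 (- Re (P c)))"
    using abs by (intro mult_left_mono) auto
  finally have "pi * norm ((deriv ^^ 2) P s) \<le> 16 / R\<^sup>2 * (18 * A + 6 * pi * max 0 (- Re (P c)))"
    by (simp add: norm_mult)
  \<comment> \<open>Since \<open>18 \<le> 6 * pi\<close>, the factor pi can be split off and
    cancelled, leaving 96 = 16 * 6.\<close>
  also have "\<dots> \<le> 16 / R\<^sup>2 * (pi * 6 * (A + max 0 (- Re (P c))))"
  proof (intro mult_left_mono)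
    have "0 \<le> integral I (\<lambda>\<theta>. max 0 (u \<theta>))" by (intro integral_nonneg int_abs) auto
    then have "0 \<le> A" using A by (simp add: u_def I_def)
    then have "18 * A \<le> pi * 6 * A" using pi_gt3 by (simp add: mult_right_mono)
    then show "18 * A + 6 * pi * max 0 (- Re (P c)) \<le> pi * 6 * (A + max 0 (- Re (P c)))"
      by (simp add: algebra_simps)
  qed auto
  also have "\<dots> = pi * (96 / R\<^sup>2 * (A + max 0 (- Re (P c))))" by simp
  finally show ?thesis by (simp only: mult_le_cancel_left_pos[OF pi_gt_zero])
qed

section \<open>Almost periodicity\<close>

text \<open>The antiderivative is \<open>arctan ((t - Im \<rho>) / x) / x\<close> with
  \<open>x \<ge> 1\<close>, and arctan varies by less than pi. The bound is independent of T and of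
  Im \<rho>, so that a sum over zeros and poles integrates to at most pi times their number.\<close>

lemma integral_inverse_square_bound:
  assumes \<rho>: "Re \<rho> \<le> c - 1" and T: "0 \<le> T"
  shows "integral {0..T} (\<lambda>t. 1 / (norm (Complex c t - \<rho>))\<^sup>2) \<le> pi"
proof -
  define x where "x = c - Re \<rho>"
  have x: "1 \<le> x" using \<rho> by (simp add: x_def)
  have sq: "(norm (Complex c t - \<rho>))\<^sup>2 = x\<^sup>2 + (t - Im \<rho>)\<^sup>2" for t
    by (simp add: cmod_power2 x_def)
  have "((\<lambda>t. 1 / (norm (Complex c t - \<rho>))\<^sup>2) has_integral
      arctan ((T - Im \<rho>) / x) / x - arctan ((0 - Im \<rho>) / x) / x) {0..T}"
  proof (rule fundamental_theorem_of_calculus[OF T])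
    fix t
    have "x\<^sup>2 + (t - Im \<rho>)\<^sup>2 \<noteq> 0" using x by (simp add: sum_power2_eq_zero_iff)
    then have "((\<lambda>t. arctan ((t - Im \<rho>) / x) / x) has_real_derivative 1 / (x\<^sup>2 + (t - Im \<rho>)\<^sup>2)) (at t within {0..T})"
      using x by (auto intro!: derivative_eq_intros simp: divide_simps power2_eq_square)
    then show "((\<lambda>t. arctan ((t - Im \<rho>) / x) / x) has_vector_derivative 1 / (norm (Complex c t - \<rho>))\<^sup>2)
        (at t within {0..T})"
      unfolding sq by (simp add: has_real_derivative_iff_has_vector_derivative)
  qed
  then have "integral {0..T} (\<lambda>t. 1 / (norm (Complex c t - \<rho>))\<^sup>2) =
      (arctan ((T - Im \<rho>) / x) - arctan ((0 - Im \<rho>) / x)) / x"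
    by (simp add: integral_unique diff_divide_distrib)
  also have "\<dots> \<le> pi / x"
    using arctan_ubound[of "(T - Im \<rho>) / x"] arctan_lbound[of "(0 - Im \<rho>) / x"] x
    by (intro divide_right_mono) linarith+
  also have "\<dots> \<le> pi" using x by (simp add: divide_le_eq)
  finally show ?thesis .
qed

text \<open>Pigeonhole: the orbit of a linear flow on a torus is totally bounded.\<close>
lemma relatively_dense_near_periods:
  fixes lam :: "nat \<Rightarrow> real"
  assumes e: "0 < e"
  obtains L where "0 < L" "\<And>x. \<exists>\<tau>\<in>{x..x+L}. \<forall>n<N. norm (cis (lam n * \<tau>) - 1) \<le> e"
proof -
  \<comment> \<open>The cells have side \<open>1 / K = e / 2\<close> in both the real and the
    imaginary coordinate, so two points in one cell differ by at most e.\<close>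
  define K :: real where "K = 2 / e"
  have K: "0 < K" using e by (simp add: K_def)
  define cell where "cell = (\<lambda>t. map (\<lambda>n. (\<lfloor>K * cos (lam n * t)\<rfloor>, \<lfloor>K * sin (lam n * t)\<rfloor>)) [0..<N])"
  let ?B = "{\<lfloor>-K\<rfloor>..\<lfloor>K\<rfloor>} \<times> {\<lfloor>-K\<rfloor>..\<lfloor>K\<rfloor>}"
  have b: "\<lfloor>K * y\<rfloor> \<in> {\<lfloor>-K\<rfloor>..\<lfloor>K\<rfloor>}" if "-1 \<le> y" "y \<le> 1" for y
  proof -
    have "K * -1 \<le> K * y" "K * y \<le> K * 1" using that K by (intro mult_left_mono; simp)+
    then show ?thesis by (auto intro!: floor_mono)
  qed
  have "cell t \<in> {xs. set xs \<subseteq> ?B \<and> length xs = N}" for t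
    using b by (auto simp: cell_def)
  then have "range cell \<subseteq> {xs. set xs \<subseteq> ?B \<and> length xs = N}" by blast
  moreover have "finite {xs. set xs \<subseteq> ?B \<and> length xs = N}" by (rule finite_lists_length_eq) simp
  ultimately have fin: "finite (range cell)" by (rule finite_subset)
  \<comment> \<open>One chosen time per visited cell. There are finitely many of them, hence all lie
    within some M, and \<open>t - rep t\<close> is a near period within M of t; centring at
    \<open>t = x + M\<close> puts it into a window of length 2 M.\<close>
  define rep where "rep = (\<lambda>t. inv cell (cell t))"
  have rep: "cell (rep t) = cell t" for t by (simp add: rep_def f_inv_into_f)
  have "range rep = inv cell ` range cell" by (auto simp: rep_def)
  then have "finite (range rep)" using fin by simp
  then have "bounded (range rep)" by (rule finite_imp_bounded)
  then obtain M where M: "0 < M" "\<And>t. \<bar>rep t\<bar> \<le> M"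
    unfolding bounded_pos by auto
  show ?thesis
  proof (rule that[of "2 * M"])
    show "0 < 2 * M" using M by simp
    fix x
    define t where "t = x + M"
    define \<tau> where "\<tau> = t - rep t"
    have "\<tau> \<in> {x..x + 2 * M}" using M(2)[of t] by (auto simp: \<tau>_def t_def abs_le_iff)
    moreover have "norm (cis (lam n * \<tau>) - 1) \<le> e" if "n < N" for n
    proof -
      have *: "cell (rep t) ! n = cell t ! n" using rep by simp
      then have fl: "\<lfloor>K * cos (lam n * rep t)\<rfloor> = \<lfloor>K * cos (lam n * t)\<rfloor>"
        "\<lfloor>K * sin (lam n * rep t)\<rfloor> = \<lfloor>K * sin (lam n * t)\<rfloor>"
        using that by (auto simp: cell_def)
      have cl: "\<bar>a - b\<bar> \<le> e / 2" if "\<lfloor>K * a\<rfloor> = \<lfloor>K * b\<rfloor>" for a b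
      proof -
        have "\<bar>K * a - K * b\<bar> \<le> 1" using that by linarith
        then have "K * \<bar>a - b\<bar> \<le> 1" using K by (simp add: abs_mult flip: right_diff_distrib)
        then show ?thesis using e by (simp add: K_def field_simps)
      qed
      have "lam n * t = lam n * \<tau> + lam n * rep t" by (simp add: \<tau>_def algebra_simps)
      then have "(cis (lam n * \<tau>) - 1) * cis (lam n * rep t) = cis (lam n * t) - cis (lam n * rep t)"
        by (simp add: algebra_simps cis_mult)
      then have "norm (cis (lam n * \<tau>) - 1) = norm (cis (lam n * t) - cis (lam n * rep t))"
        by (metis norm_mult norm_cis mult.right_neutral)
      also have "\<dots> \<le> \<bar>Re (cis (lam n * t) - cis (lam n * rep t))\<bar> + \<bar>Im (cis (lam n * t) - cis (lam n * rep t))\<bar>"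
        by (rule cmod_le)
      also have "\<dots> \<le> e / 2 + e / 2"
        using cl[OF fl(1)] cl[OF fl(2)] by (intro add_mono) (simp_all add: abs_minus_commute)
      finally show ?thesis by simp
    qed
    ultimately show "\<exists>\<tau>\<in>{x..x + 2 * M}. \<forall>n<N. norm (cis (lam n * \<tau>) - 1) \<le> e" by blast
  qed
qed

text \<open>Cauchy's inequality on a disc of radius d, applied to the difference
  \<open>f (z + \<i> \<tau>) - f z\<close>. Thus a near period of a function serves its derivative
  too, at the price of a strip narrower by d on each side.\<close>

lemma deriv_near_period:
  fixes f :: "complex \<Rightarrow> complex"
  assumes hol: "f holomorphic_on S" "open S" and S: "\<And>s. \<alpha> - d \<le> Re s \<Longrightarrow> Re s \<le> \<beta> + d \<Longrightarrow> s \<in> S"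
    and d: "0 < d"
    and per: "\<And>s. \<alpha> - d \<le> Re s \<Longrightarrow> Re s \<le> \<beta> + d \<Longrightarrow> norm (f (s + \<i> * of_real \<tau>) - f s) \<le> e"
    and s: "\<alpha> \<le> Re s" "Re s \<le> \<beta>"
  shows "norm (deriv f (s + \<i> * of_real \<tau>) - deriv f s) \<le> e / d"
proof -
  define w where "w = \<i> * of_real \<tau>"
  have in_strip: "\<alpha> - d \<le> Re z \<and> Re z \<le> \<beta> + d" if "z \<in> cball s d" for z
  proof -
    have "\<bar>Re (s - z)\<bar> \<le> d" using that abs_Re_le_cmod[of "s - z"] by (simp add: dist_norm)
    then show ?thesis using s by auto
  qed
  have in_S: "z \<in> S" "z + w \<in> S" if "z \<in> cball s d" for z
    using in_strip[OF that] by (auto intro!: S simp: w_def)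
  define h where "h = (\<lambda>z. f (z + w) - f z)"
  have fd: "(f has_field_derivative deriv f z) (at z)" if "z \<in> S" for z
    using holomorphic_derivI[OF hol(1,2) that] .
  have hd: "(h has_field_derivative deriv f (z + w) - deriv f z) (at z)" if "z \<in> cball s d" for z
    unfolding h_def using in_S[OF that] by (intro DERIV_diff fd) (simp_all add: DERIV_shift[symmetric] fd)
  have "norm ((deriv ^^ 1) h s) \<le> fact 1 * e / d ^ 1"
  proof (rule Cauchy_inequality[OF _ _ d])
    show "h holomorphic_on ball s d"
      unfolding holomorphic_on_open[OF open_ball] using hd by (meson ball_subset_cball subsetD)
    show "continuous_on (cball s d) h"
      using hd by (intro DERIV_continuous_on) (auto intro: has_field_derivative_at_within)
    show "norm (h x) \<le> e" if "norm (s - x) = d" for x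
      unfolding h_def w_def using in_strip[of x] that by (intro per) (auto simp: dist_norm)
  qed
  also have "(deriv ^^ 1) h s = deriv f (s + w) - deriv f s"
    using hd[of s] d by (simp add: DERIV_imp_deriv)
  finally show ?thesis by (simp add: w_def)
qed

text \<open>If h is nonzero somewhere, continuity makes |h| large on a short interval, and near
  periods repeat that interval in every window of a fixed length \<open>L'\<close>. So the integral
  grows at least linearly for all large T, which a small mean at a single large T
  contradicts.\<close>

lemma almost_periodic_mean_zero:
  fixes h :: "real \<Rightarrow> complex"
  assumes cont: "continuous_on UNIV h"
    and ap: "\<And>e. 0 < e \<Longrightarrow> \<exists>L>0. \<forall>x. \<exists>\<tau>\<in>{x..x+L}. \<forall>t. norm (h (t + \<tau>) - h t) \<le> e"
    and mean: "\<And>\<eta> T0. 0 < \<eta> \<Longrightarrow> \<exists>T\<ge>T0. integral {0..T} (\<lambda>t. norm (h t)) \<le> \<eta> * T"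
  shows "h t1 = 0"
proof (rule ccontr)
  assume "h t1 \<noteq> 0"
  define \<delta> where "\<delta> = norm (h t1) / 3"
  have \<delta>: "0 < \<delta>" "norm (h t1) = 3 * \<delta>" using \<open>h t1 \<noteq> 0\<close> by (simp_all add: \<delta>_def)
  obtain d' where d': "d' > 0" "\<And>t. dist t t1 < d' \<Longrightarrow> dist (h t) (h t1) < \<delta>"
    using cont \<delta>(1) unfolding continuous_on_iff by (metis UNIV_I)
  define d where "d = d' / 2"
  have d: "0 < d" using d' by (simp add: d_def)
  have near: "2 * \<delta> \<le> norm (h t)" if "\<bar>t - t1\<bar> \<le> d" for t
  proof -
    have "dist (h t) (h t1) < \<delta>" using that d' by (intro d'(2)) (auto simp: dist_real_def d_def)
    then show ?thesis using \<delta>(2) norm_triangle_ineq2[of "h t1" "h t"] by (simp add: dist_norm norm_minus_commute)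
  qed
  obtain L where L: "0 < L" "\<And>x. \<exists>\<tau>\<in>{x..x+L}. \<forall>t. norm (h (t + \<tau>) - h t) \<le> \<delta>"
    using ap[OF \<delta>(1)] by blast
  define L' where "L' = L + 2 * d"
  have L': "0 < L'" using L d by (simp add: L'_def)
  have int: "(\<lambda>t. norm (h t)) integrable_on {a..b}" for a b
    by (intro integrable_continuous_real continuous_intros continuous_on_subset[OF cont]) auto
  have block: "2 * d * \<delta> \<le> integral {x..x+L'} (\<lambda>t. norm (h t))" for x
  proof -
    \<comment> \<open>The window for \<tau> is shifted so that the translate of
      \<open>[t1 - d, t1 + d]\<close> falls inside \<open>[x, x + L + 2 d]\<close>.\<close>
    obtain \<tau> where \<tau>: "\<tau> \<in> {x + d - t1..x + d - t1 + L}" "\<And>t. norm (h (t + \<tau>) - h t) \<le> \<delta>"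
      using L(2)[of "x + d - t1"] by auto
    have "2 * d * \<delta> = integral {t1 + \<tau> - d..t1 + \<tau> + d} (\<lambda>_. \<delta>)" using d by simp
    also have "\<dots> \<le> integral {t1 + \<tau> - d..t1 + \<tau> + d} (\<lambda>t. norm (h t))"
    proof (rule integral_le)
      fix u assume "u \<in> {t1 + \<tau> - d..t1 + \<tau> + d}"
      then have "2 * \<delta> \<le> norm (h (u - \<tau>))" by (intro near) (auto simp: abs_le_iff)
      then show "\<delta> \<le> norm (h u)"
        using \<tau>(2)[of "u - \<tau>"] norm_triangle_ineq2[of "h (u - \<tau>)" "h u"] by (simp add: norm_minus_commute)
    qed (auto intro: int)
    also have "\<dots> \<le> integral {x..x+L'} (\<lambda>t. norm (h t))"
      using \<tau>(1) by (intro integral_subset_le int) (auto simp: L'_def)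
    finally show ?thesis .
  qed
  have blocks: "real n * (2 * d * \<delta>) \<le> integral {0..real n * L'} (\<lambda>t. norm (h t))" for n
  proof (induction n)
    case (Suc n)
    have "integral {0..real n * L'} (\<lambda>t. norm (h t)) + integral {real n * L'..real (Suc n) * L'} (\<lambda>t. norm (h t))
        = integral {0..real (Suc n) * L'} (\<lambda>t. norm (h t))"
      using L' by (intro Henstock_Kurzweil_Integration.integral_combine int mult_right_mono mult_nonneg_nonneg) auto
    then show ?case using Suc block[of "real n * L'"] by (simp add: algebra_simps)
  qed simp
  \<comment> \<open>A quarter of the mean \<open>2 d \<delta> / L'\<close> over a block: one factor
    2 pays for \<open>T < 2 n L'\<close>, the other yields the contradiction.\<close>
  define \<eta> where "\<eta> = d * \<delta> / (2 * L')"
  have \<eta>: "0 < \<eta>" using d \<delta> L' by (simp add: \<eta>_def)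
  obtain T where T: "L' \<le> T" "integral {0..T} (\<lambda>t. norm (h t)) \<le> \<eta> * T"
    using mean[OF \<eta>] by blast
  define n where "n = nat \<lfloor>T / L'\<rfloor>"
  have TL: "1 \<le> T / L'" using T(1) L' by simp
  then have n: "real n \<le> T / L'" "T / L' < real n + 1" "1 \<le> real n"
    unfolding n_def by (simp_all add: le_nat_iff floor_le_iff le_floor_iff nat_le_iff)
  have nT: "real n * L' \<le> T" using n(1) L' by (simp add: field_simps)
  have "T < (real n + 1) * L'" using n(2) L' by (simp add: field_simps)
  also have "\<dots> \<le> (2 * real n) * L'" using n(3) L' by (intro mult_right_mono) auto
  finally have T2: "T < 2 * real n * L'" .
  have "real n * (2 * d * \<delta>) \<le> integral {0..real n * L'} (\<lambda>t. norm (h t))" by (rule blocks)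
  also have "\<dots> \<le> integral {0..T} (\<lambda>t. norm (h t))"
    using nT by (intro integral_subset_le int) auto
  also have "\<dots> \<le> \<eta> * T" by (rule T(2))
  also have "\<dots> < \<eta> * (2 * real n * L')" using T2 \<eta> by (intro mult_strict_left_mono) auto
  also have "\<dots> = real n * (d * \<delta>)" using L' by (simp add: \<eta>_def)
  finally have "real n * (2 * d * \<delta>) < real n * (d * \<delta>)" .
  then show False using n(3) d \<delta> by (simp add: mult_less_cancel_left)
qed

section \<open>Zeros and poles of a nonconstant meromorphic function\<close>

text \<open>A nicely meromorphic function has value 0 at its poles and its limit as value everywhere
  else. Hence \<open>g s \<noteq> 0\<close> excludes a pole as well as a zero, and g is determined
  at every point by its values nearby.\<close>

locale nonconstant_meromorphic =
  fixes g :: "complex \<Rightarrow> complex"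
  assumes mero: "g nicely_meromorphic_on UNIV"
    and nonconst: "\<not> (\<exists>c. \<forall>s. g s = c)"
begin

definition divisor :: "complex set" where "divisor = {z. zorder g z \<noteq> 0}"

lemma mero_at: "g meromorphic_on {z}"
  using mero meromorphic_on_subset unfolding nicely_meromorphic_on_def by blast

lemma cosparse_nz: "\<forall>\<^sub>\<approx>x\<in>UNIV. g x \<noteq> 0"
  using nicely_meromorphic_imp_constant_or_avoid[OF mero, of 0] nonconst by auto

lemma eventually_nz: "eventually (\<lambda>w. g w \<noteq> 0) (at z)"
  using cosparse_nz by (simp add: eventually_cosparse_open_eq)

lemma frequently_nz: "frequently (\<lambda>w. g w \<noteq> 0) (at z)"
  using eventually_nz by (simp add: eventually_frequently)

text \<open>A pole would have negative order, so order 0 leaves a point of analyticity, and there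
  order 0 means a nonzero value.\<close>

lemma regular:
  assumes "z \<notin> divisor"
  shows "g analytic_on {z}" "g z \<noteq> 0"
proof -
  have "\<not> is_pole g z"
    using assms isolated_pole_imp_neg_zorder meromorphic_on_isolated_singularity[OF mero_at, of z]
    unfolding divisor_def by force
  then show "g analytic_on {z}"
    using nicely_meromorphic_on_imp_analytic_at[OF mero] by auto
  then show "g z \<noteq> 0"
    using zorder_eq_0_iff[OF _ frequently_nz] assms unfolding divisor_def by auto
qed

lemma not_in_divisor: "g analytic_on {z} \<Longrightarrow> g z \<noteq> 0 \<Longrightarrow> z \<notin> divisor"
  by (auto simp: divisor_def zorder_eq_0I)

lemma finite_divisor: "finite (divisor \<inter> cball 0 r)"
proof -
  have "\<forall>\<^sub>\<approx>z\<in>UNIV. g analytic_on {z} \<and> g z \<noteq> 0"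
    using meromorphic_on_imp_analytic_cosparse[of g UNIV] cosparse_nz mero
    by (intro eventually_conj) (auto simp: nicely_meromorphic_on_def)
  then have "\<forall>\<^sub>\<approx>z\<in>UNIV. z \<notin> divisor"
    by eventually_elim (use not_in_divisor in auto)
  then have "divisor sparse_in UNIV" by (simp add: eventually_cosparse)
  then have "divisor sparse_in cball 0 r" using sparse_in_subset by blast
  then show ?thesis
    using sparse_in_compact_finite[of divisor "cball 0 r"] by (simp add: Int_commute)
qed

lemma finite_divisor_ball: "finite (divisor \<inter> ball 0 r)"
  by (rule finite_subset[OF _ finite_divisor[of r]]) auto

definition divisor_count :: "real \<Rightarrow> real" where
  "divisor_count r = (\<Sum>z\<in>divisor \<inter> cball 0 r. \<bar>real_of_int (zorder g z)\<bar>)"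

lemma zero_count_plus_pole_count: "zero_count g r + pole_count g r = divisor_count r"
proof -
  let ?A = "{z. z \<in> cball 0 r \<and> 0 < zorder g z}" and ?B = "{z. z \<in> cball 0 r \<and> zorder g z < 0}"
  have AB: "divisor \<inter> cball 0 r = ?A \<union> ?B" "?A \<inter> ?B = {}" by (auto simp: divisor_def)
  then have fin: "finite ?A" "finite ?B" using finite_divisor[of r] by auto
  have "divisor_count r = (\<Sum>z\<in>?A. \<bar>real_of_int (zorder g z)\<bar>) + (\<Sum>z\<in>?B. \<bar>real_of_int (zorder g z)\<bar>)"
    unfolding divisor_count_def AB(1) by (rule sum.union_disjoint) (use fin AB in auto)
  also have "(\<Sum>z\<in>?A. \<bar>real_of_int (zorder g z)\<bar>) = zero_count g r"
    unfolding zero_count_def of_nat_sum by (rule sum.cong) auto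
  also have "(\<Sum>z\<in>?B. \<bar>real_of_int (zorder g z)\<bar>) = pole_count g r"
    unfolding pole_count_def of_nat_sum by (rule sum.cong) auto
  finally show ?thesis by simp
qed

text \<open>The finite product over the zeros and poles in the disc has the same order as g at each
  point of the disc. The quotient therefore extends to a zero-free holomorphic function, which has a
  holomorphic logarithm because a disc is simply connected.\<close>

lemma factorization:
  assumes r: "0 < r"
  obtains p where "p holomorphic_on ball 0 r"
    "\<And>s. s \<in> ball 0 r - divisor \<Longrightarrow> g s = (\<Prod>\<rho>\<in>divisor \<inter> ball 0 r. (s - \<rho>) powi zorder g \<rho>) * exp (p s)"
proof -
  define S where "S = divisor \<inter> ball 0 r"
  have fS: "finite S" unfolding S_def by (rule finite_divisor_ball)
  define Q where "Q = (\<lambda>s. \<Prod>\<rho>\<in>S. (s - \<rho>) powi zorder g \<rho>)"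
  have Qnz: "Q s \<noteq> 0" if "s \<notin> S" for s
    using that fS by (auto simp: Q_def)
  have Qan: "Q analytic_on {s}" if "s \<notin> S" for s
    unfolding Q_def using that by (intro analytic_intros) auto
  have evS: "\<forall>\<^sub>F w in at z. w \<notin> S" for z
    using fS by (metis finite_imp_sparse eventually_not_in_cosparse UNIV_I eventually_cosparse_imp_eventually_at)
  have evQ: "\<forall>\<^sub>F w in at z. Q w \<noteq> 0" for z
    using evS by eventually_elim (rule Qnz)
  have Qmero: "Q meromorphic_on {z}" for z
    unfolding Q_def by (intro meromorphic_intros)
  have zo1: "zorder (\<lambda>s. (s - \<rho>) powi zorder g \<rho>) z = (if \<rho> = z then zorder g \<rho> else 0)" for \<rho> z
  proof -
    have "zorder (\<lambda>s. s - \<rho>) z = (if \<rho> = z then 1 else 0)"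
    proof (cases "\<rho> = z")
      case True
      have "zorder (\<lambda>s. s - \<rho>) z = 1"
        by (rule zorder_eqI[where S = UNIV and g = "\<lambda>_. 1"]) (use True in auto)
      then show ?thesis using True by simp
    next
      case False
      then show ?thesis by (auto intro!: zorder_eq_0I analytic_intros)
    qed
    moreover have "\<forall>\<^sub>F w in at z. w - \<rho> \<noteq> 0"
      using eventually_neq_at_within[of \<rho>] by simp
    then have "\<exists>\<^sub>F w in at z. w - \<rho> \<noteq> 0" by (simp add: eventually_frequently)
    ultimately show ?thesis
      by (subst zorder_power_int) (auto intro!: meromorphic_intros)
  qed
  have zoQ: "zorder Q z = zorder g z" if "z \<in> ball 0 r" for z
  proof -
    have "zorder Q z = (\<Sum>\<rho>\<in>S. zorder (\<lambda>s. (s - \<rho>) powi zorder g \<rho>) z)"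
      unfolding Q_def by (rule zorder_prod) (use evQ in \<open>auto intro!: meromorphic_intros simp: Q_def\<close>)
    also have "\<dots> = (if z \<in> S then zorder g z else 0)"
      using fS by (simp add: zo1 sum.delta')
    also have "\<dots> = zorder g z" using that by (auto simp: S_def divisor_def)
    finally show ?thesis .
  qed
  \<comment> \<open>At a point of the divisor the raw quotient has a meaningless value;
    \<open>remove_sings\<close> replaces it by the limit.\<close>
  define h where "h = remove_sings (\<lambda>s. g s / Q s)"
  have hm: "(\<lambda>s. g s / Q s) meromorphic_on {z}" for z
    by (intro meromorphic_intros mero_at Qmero)
  have hnice: "h nicely_meromorphic_on {z}" for z
    unfolding h_def by (rule remove_sings_nicely_meromorphic[OF hm])
  have nz: "\<forall>\<^sub>F w in at z. g w / Q w \<noteq> 0" for z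
    using evQ[of z] eventually_nz[of z] by eventually_elim auto
  have h_reg: "h analytic_on {z} \<and> h z \<noteq> 0" if z: "z \<in> ball 0 r" for z
  proof -
    have iso: "isolated_singularity_at (\<lambda>s. g s / Q s) z" "not_essential (\<lambda>s. g s / Q s) z"
      using hm[of z] by (auto simp: meromorphic_at_iff)
    have zo: "zorder (\<lambda>s. g s / Q s) z = 0"
      using zoQ[OF z] by (subst zorder_divide)
        (auto intro!: mero_at Qmero simp: frequently_nz eventually_frequently[OF at_neq_bot evQ])
    have hz: "zorder h z = 0" using zo iso by (simp add: h_def)
    have nzh: "\<forall>\<^sub>F w in at z. h w \<noteq> 0"
      using nz[of z] eventually_remove_sings_eq_at[OF iso(1)] unfolding h_def
      by eventually_elim auto
    have "\<not> is_pole h z"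
      using hz isolated_pole_imp_neg_zorder[of h z] iso by (auto simp: h_def)
    then have "h analytic_on {z}"
      using nicely_meromorphic_on_imp_analytic_at[OF hnice] by auto
    moreover have "h z \<noteq> 0"
      using zorder_eq_0_iff[OF calculation] hz nzh by (simp add: eventually_frequently)
    ultimately show ?thesis ..
  qed
  have "h holomorphic_on ball 0 r"
    by (rule analytic_imp_holomorphic) (use h_reg analytic_on_analytic_at in blast)
  then obtain p where p: "p holomorphic_on ball 0 r" "\<And>x. x \<in> ball 0 r \<Longrightarrow> exp (p x) = h x"
    using holomorphic_logarithm_exists[of "ball 0 r" h 0] h_reg r by auto
  show ?thesis
  proof (rule that[OF p(1)])
    fix s assume s: "s \<in> ball 0 r - divisor"
    then have "s \<notin> S" by (auto simp: S_def)
    have "(\<lambda>s. g s / Q s) analytic_on {s}"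
      using Qan[OF \<open>s \<notin> S\<close>] Qnz[OF \<open>s \<notin> S\<close>] regular(1)[of s] s by (intro analytic_intros) auto
    then have "h s = g s / Q s" unfolding h_def by simp
    then show "g s = (\<Prod>\<rho>\<in>divisor \<inter> ball 0 r. (s - \<rho>) powi zorder g \<rho>) * exp (p s)"
      using p(2)[of s] s Qnz[OF \<open>s \<notin> S\<close>] by (simp add: Q_def S_def)
  qed
qed

end

section \<open>Growth of the logarithmic derivative\<close>

text \<open>The order is a limes superior of \<open>ln T(r) / ln r\<close>, so any natural number
  above it serves as exponent for all large r.\<close>

lemma nev_T_polynomial_bound:
  assumes "nev_order f < \<infinity>"
  obtains N :: nat where "\<forall>\<^sub>F r in at_top. nev_T f r \<le> r ^ N"
proof -
  obtain N :: nat where "nev_order f < ereal (real N)"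
    using assms less_PInf_Ex_of_nat[of "nev_order f"] by auto
  then have "\<forall>\<^sub>F r in at_top. ereal (ln (nev_T f r) / ln r) < ereal (real N)"
    unfolding nev_order_def by (rule Limsup_lessD)
  with eventually_gt_at_top[of 1] have "\<forall>\<^sub>F r in at_top. nev_T f r \<le> r ^ N"
  proof eventually_elim
    case (elim r)
    then have lr: "0 < ln r" "0 < r" by auto
    show ?case
    proof (cases "0 < nev_T f r")
      case True
      have "ln (nev_T f r) < real N * ln r" using elim lr by (simp add: divide_less_eq)
      also have "real N * ln r = ln (r ^ N)" using lr by (simp add: ln_realpow)
      finally show ?thesis using True lr by simp
    next
      \<comment> \<open>Where the characteristic is not positive its logarithm carries no
        information, but the bound is trivial.\<close>
      case False
      then show ?thesis using lr by (smt (verit) zero_less_power)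
    qed
  qed
  then show ?thesis by (rule that)
qed

lemma ln_power_int:
  fixes x :: real
  assumes "0 < x"
  shows "ln (x powi n) = of_int n * ln x"
proof -
  have "x powi n = x powr of_int n" using assms by (simp add: powr_real_of_int')
  then show ?thesis using assms by (simp add: ln_powr)
qed

context nonconstant_meromorphic
begin

text \<open>The summand of the convergence criterion. The shift \<open>1 + norm \<rho>\<close> keeps
  a zero or pole at the origin harmless, and since the order is 0 off the divisor, sums may run over
  the whole plane.\<close>

definition weight :: "complex \<Rightarrow> real" where
  "weight \<rho> = \<bar>real_of_int (zorder g \<rho>)\<bar> / (1 + norm \<rho>)\<^sup>2"

lemma weight_nonneg: "0 \<le> weight \<rho>" by (simp add: weight_def)

lemma weight_outside: "\<rho> \<notin> divisor \<Longrightarrow> weight \<rho> = 0" by (simp add: weight_def divisor_def)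

text \<open>Each point of the disc has weight at least its multiplicity divided by
  \<open>(1 + r)^2\<close>. This crude quadratic bound is enough wherever only polynomial growth
  matters.\<close>

lemma divisor_count_le:
  assumes "weight summable_on UNIV" "0 \<le> r"
  shows "divisor_count r \<le> (1 + r)\<^sup>2 * infsum weight UNIV"
proof -
  have "divisor_count r \<le> (\<Sum>\<rho>\<in>divisor \<inter> cball 0 r. (1 + r)\<^sup>2 * weight \<rho>)"
    unfolding divisor_count_def
  proof (rule sum_mono)
    fix \<rho> assume "\<rho> \<in> divisor \<inter> cball 0 r"
    then have "(1 + norm \<rho>)\<^sup>2 \<le> (1 + r)\<^sup>2" by (intro power_mono) auto
    then have "(1 + norm \<rho>)\<^sup>2 * weight \<rho> \<le> (1 + r)\<^sup>2 * weight \<rho>" by (intro mult_right_mono weight_nonneg)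
    moreover have "1 + norm \<rho> \<noteq> 0" using norm_ge_zero[of \<rho>] by linarith
    ultimately show "\<bar>real_of_int (zorder g \<rho>)\<bar> \<le> (1 + r)\<^sup>2 * weight \<rho>" by (simp add: weight_def)
  qed
  also have "\<dots> = (1 + r)\<^sup>2 * (\<Sum>\<rho>\<in>divisor \<inter> cball 0 r. weight \<rho>)" by (simp add: sum_distrib_left)
  also have "\<dots> \<le> (1 + r)\<^sup>2 * infsum weight UNIV"
    by (intro mult_left_mono finite_sum_le_infsum assms finite_divisor) (auto simp: weight_nonneg)
  finally show ?thesis .
qed

text \<open>This allows the proximity function to be bounded by the characteristic. The integrand is
  nonnegative because the pole count increases; if it were not integrable, its integral would be 0
  by convention. \<open>1 \<le> r\<close> makes \<open>ln r\<close> nonnegative.\<close>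

lemma nev_N_nonneg:
  assumes "1 \<le> r" shows "0 \<le> nev_N g r"
proof -
  have mono: "pole_count g 0 \<le> pole_count g t" if "0 \<le> t" for t
  proof -
    have "finite {z. z \<in> cball 0 t \<and> zorder g z < 0}"
      by (rule finite_subset[OF _ finite_divisor[of t]]) (auto simp: divisor_def)
    then show ?thesis unfolding pole_count_def
      using that by (intro of_nat_mono sum_mono2) auto
  qed
  have "0 \<le> integral {0..r} (\<lambda>t. (pole_count g t - pole_count g 0) / t)"
  proof (cases "(\<lambda>t. (pole_count g t - pole_count g 0) / t) integrable_on {0..r}")
    case True
    then show ?thesis by (rule integral_nonneg) (use mono in auto)
  qed (simp add: not_integrable_integral)
  moreover have "0 \<le> pole_count g 0" unfolding pole_count_def by (rule of_nat_0_le_iff)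
  ultimately show ?thesis using assms by (simp add: nev_N_def)
qed

definition logderiv :: "complex \<Rightarrow> complex" where "logderiv s = deriv g s / g s"

text \<open>
  The Blaschke-type factors below replace each \<open>s - \<rho>\<close> by a zero-free factor of the same modulus
  on the circle \<open>|s| = R\<close>, so that the real part of the resulting logarithm is \<open>ln |g|\<close> there.
\<close>
lemma log_derivative_growth:
  assumes summ: "weight summable_on UNIV" and ord: "nev_order g < \<infinity>"
    and c: "1 \<le> c" "\<And>z. z \<in> divisor \<Longrightarrow> Re z \<le> c - 2"
  shows "\<exists>M C R0. 0 \<le> C \<and> 1 \<le> R0 \<and>
    (\<forall>R\<ge>R0. divisor \<inter> sphere 0 R = {} \<longrightarrow>
      (\<exists>q. q holomorphic_on ball 0 R \<and> (\<forall>s. norm s \<le> R / 2 \<longrightarrow> norm (q s) \<le> C * R ^ M) \<and>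
        (\<forall>s \<in> ball 0 R - divisor. q s = deriv logderiv s + (\<Sum>\<rho>\<in>divisor \<inter> cball 0 R. of_int (zorder g \<rho>) / (s - \<rho>)\<^sup>2))))"
proof -
  obtain N where N: "\<forall>\<^sub>F r in at_top. nev_T g r \<le> r ^ N"
    using nev_T_polynomial_bound[OF ord] .
  then obtain R1 where R1: "\<And>r. R1 \<le> r \<Longrightarrow> nev_T g r \<le> r ^ N"
    unfolding eventually_at_top_linorder by blast
  define V where "V = infsum weight UNIV"
  have V: "0 \<le> V" unfolding V_def by (intro infsum_nonneg weight_nonneg)
  have cD: "of_real c \<notin> divisor" using c(2)[of "of_real c"] by auto
  define a where "a = \<bar>ln (norm (g (of_real c)))\<bar>"
  \<comment> \<open>\<open>R1\<close> for the growth bound, \<open>2 * c\<close> so that the base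
    point c lies in the disc of radius R/2, and 2 so that \<open>R / 2 \<ge> 1\<close>.\<close>
  define R0 where "R0 = max R1 (max (2 * c) 2)"
  \<comment> \<open>96 is the constant of the second derivative bound; 7 stands for 2 pi times the
    proximity function, \<open>a + 8 * V\<close> for the lower bound at c, and \<open>16 * V\<close>
    for the reflected terms. The cubic factor in that lower bound explains the exponent
    \<open>N + 3\<close>.\<close>
  define C where "C = 96 * (7 + a + 8 * V) + 16 * V"
  show ?thesis
  proof (rule exI[of _ "N + 3"], rule exI[of _ C], rule exI[of _ R0], intro conjI allI impI)
    show "0 \<le> C" using V by (simp add: C_def a_def)
    show "1 \<le> R0" by (simp add: R0_def)
    fix R assume R: "R0 \<le> R" and gen: "divisor \<inter> sphere 0 R = {}"
    have Rb: "R1 \<le> R" "2 * c \<le> R" "2 \<le> R" using R by (auto simp: R0_def)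
    define S where "S = divisor \<inter> cball 0 R"
    have fS: "finite S" unfolding S_def by (rule finite_divisor)
    have S_ball: "norm \<rho> < R" if "\<rho> \<in> S" for \<rho>
      using that gen unfolding S_def by (force simp: order_le_less)
    \<comment> \<open>The factorization is needed up to and including the circle, hence on a
      slightly larger disc that contains no further zeros or poles.\<close>
    have "\<exists>R2>R. divisor \<inter> ball 0 R2 = S"
    proof -
      define X where "X = norm ` (divisor \<inter> cball 0 (R + 1)) - {..R}"
      define R2 where "R2 = Min (insert (R + 1) X)"
      have fX: "finite X" unfolding X_def using finite_divisor[of "R+1"] by auto
      have "R < R2" unfolding R2_def using fX by (subst Min_gr_iff) (auto simp: X_def)
      moreover have "divisor \<inter> ball 0 R2 = S"
      proof -
        have le: "R2 \<le> R + 1" "\<And>x. x \<in> X \<Longrightarrow> R2 \<le> x" unfolding R2_def using fX by (auto intro: Min_le)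
        have "norm z \<le> R" if "z \<in> divisor" "norm z < R2" for z
        proof (rule ccontr)
          assume "\<not> norm z \<le> R"
          then have "norm z \<in> X" unfolding X_def using that le by auto
          then show False using le(2) that by fastforce
        qed
        then show ?thesis using \<open>R < R2\<close> unfolding S_def by auto
      qed
      ultimately show ?thesis by blast
    qed
    then obtain R2 where R2: "R < R2" "divisor \<inter> ball 0 R2 = S" by blast
    have "0 < R2" using R2 Rb by linarith
    then obtain p where p: "p holomorphic_on ball 0 R2"
      "\<And>s. s \<in> ball 0 R2 - divisor \<Longrightarrow> g s = (\<Prod>\<rho>\<in>S. (s - \<rho>) powi zorder g \<rho>) * exp (p s)"
      using factorization[of R2] unfolding R2(2) by blast
    define p1 where "p1 = deriv p"
    define q where "q = deriv p1"
    have p1: "p1 holomorphic_on ball 0 R2" unfolding p1_def by (intro holomorphic_deriv p) auto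
    have q: "q holomorphic_on ball 0 R2" unfolding q_def by (intro holomorphic_deriv p1) auto
    have dp: "(p has_field_derivative p1 s) (at s)" "(p1 has_field_derivative q s) (at s)" if "s \<in> ball 0 R2" for s
      unfolding p1_def q_def using holomorphic_derivI[OF p(1) _ that] holomorphic_derivI[OF p1 _ that] by (auto simp: p1_def)

    \<comment> \<open>This is R times \<open>1 - cnj \<rho> s / R^2\<close>, which has positive real
      part on the closed disc. Hence the principal logarithm is holomorphic there.\<close>
    define b where "b = (\<lambda>\<rho> s. of_real R - cnj \<rho> * s / of_real R)"
    have Rpos: "0 < R" using Rb by linarith
    have b_dist: "norm (b \<rho> s - of_real R) \<le> norm s" if "\<rho> \<in> S" for \<rho> s
    proof -
      have "norm (b \<rho> s - of_real R) = norm \<rho> * norm s / R"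
        using Rpos by (simp add: b_def norm_mult norm_divide)
      also have "\<dots> \<le> R * norm s / R"
        using S_ball[OF that] Rpos by (intro divide_right_mono mult_right_mono) auto
      finally show ?thesis using Rpos by simp
    qed
    have b_pos: "0 < Re (b \<rho> s)" if "\<rho> \<in> S" "norm s \<le> R" for \<rho> s
    proof -
      have "norm (cnj \<rho> * s / of_real R) = norm \<rho> * norm s / R"
        using Rpos by (simp add: norm_mult norm_divide)
      also have "\<dots> \<le> norm \<rho> * R / R"
        using that Rpos by (intro divide_right_mono mult_left_mono) auto
      also have "\<dots> < R" using S_ball[OF that(1)] Rpos by simp
      finally show ?thesis using complex_Re_le_cmod[of "cnj \<rho> * s / of_real R"] unfolding b_def by simp
    qed
    then have b_np: "b \<rho> s \<notin> \<real>\<^sub>\<le>\<^sub>0" "b \<rho> s \<noteq> 0" if "\<rho> \<in> S" "norm s \<le> R" for \<rho> s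
      using that by (fastforce simp: complex_nonpos_Reals_iff)+
    \<comment> \<open>A logarithm of g with every factor \<open>s - \<rho>\<close> exchanged for
      \<open>b \<rho> s\<close>: holomorphic also at the zeros and poles, with real part ln |g| on
      the circle.\<close>
    define P where "P = (\<lambda>s. p s + (\<Sum>\<rho>\<in>S. of_int (zorder g \<rho>) * Ln (b \<rho> s)))"
    define P1 where "P1 = (\<lambda>s. p1 s + (\<Sum>\<rho>\<in>S. of_int (zorder g \<rho>) * (- cnj \<rho> / of_real R / b \<rho> s)))"
    define P2 where "P2 = (\<lambda>s. q s - (\<Sum>\<rho>\<in>S. of_int (zorder g \<rho>) * (cnj \<rho> / of_real R)\<^sup>2 / (b \<rho> s)\<^sup>2))"
    have db: "(b \<rho> has_field_derivative - cnj \<rho> / of_real R) (at s)" for \<rho> s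
    proof -
      have "(b \<rho> has_field_derivative 0 - cnj \<rho> * 1 / of_real R) (at s)"
        unfolding b_def by (intro DERIV_diff DERIV_const DERIV_cdivide DERIV_cmult DERIV_ident)
      then show ?thesis by simp
    qed
    have dP: "(P has_field_derivative P1 s) (at s)" if "norm s \<le> R" for s
      unfolding P_def P1_def
      by (intro DERIV_add DERIV_sum dp DERIV_cmult)
         (use that R2 b_np in \<open>auto intro!: derivative_eq_intros db simp: divide_inverse\<close>)
    have dP1: "(P1 has_field_derivative P2 s) (at s)" if s: "norm s \<le> R" for s
    proof -
      have d0: "((\<lambda>s. of_int (zorder g \<rho>) * (- cnj \<rho> / of_real R / b \<rho> s)) has_field_derivative
        of_int (zorder g \<rho>) * (- ((cnj \<rho> / of_real R)\<^sup>2 / (b \<rho> s)\<^sup>2))) (at s)" if "\<rho> \<in> S" for \<rho>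
        using b_np(2)[OF that s] Rpos
        by (intro DERIV_cmult) (auto intro!: derivative_eq_intros db simp: power2_eq_square)
      have "((\<lambda>s. \<Sum>\<rho>\<in>S. of_int (zorder g \<rho>) * (- cnj \<rho> / of_real R / b \<rho> s)) has_field_derivative
        (\<Sum>\<rho>\<in>S. of_int (zorder g \<rho>) * (- ((cnj \<rho> / of_real R)\<^sup>2 / (b \<rho> s)\<^sup>2)))) (at s)"
        by (intro DERIV_sum d0)
      from DERIV_add[OF dp(2) this] show ?thesis
        unfolding P1_def P2_def using s R2 by (simp add: sum_negf)
    qed
    have P_hol: "P holomorphic_on ball 0 R"
      unfolding holomorphic_on_open[OF open_ball] using dP less_imp_le by (metis mem_ball_0)
    have P_cont: "continuous_on (cball 0 R) P"
      by (rule DERIV_continuous_on) (use dP in \<open>auto intro: has_field_derivative_at_within\<close>)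
    have P_dd: "(deriv ^^ 2) P s = P2 s" if "norm s < R" for s
    proof -
      have "deriv (deriv P) s = deriv P1 s"
      proof (rule deriv_cong_ev)
        have "\<forall>\<^sub>F x in nhds s. x \<in> ball 0 R" using that by (intro eventually_nhds_in_open) auto
        then show "\<forall>\<^sub>F x in nhds s. deriv P x = P1 x"
          by eventually_elim (use dP in \<open>auto intro!: DERIV_imp_deriv\<close>)
      qed simp
      also have "\<dots> = P2 s" using dP1[of s] that by (intro DERIV_imp_deriv) auto
      finally show ?thesis by (simp add: eval_nat_numeral)
    qed
    have norm_exp_P: "exp (Re (P s)) = norm (exp (p s)) * (\<Prod>\<rho>\<in>S. norm (b \<rho> s) powi zorder g \<rho>)"
      if "norm s \<le> R" for s
    proof -
      have "exp (Re (P s)) = norm (exp (P s))" by (rule norm_exp_eq_Re[symmetric])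
      also have "exp (P s) = exp (p s) * (\<Prod>\<rho>\<in>S. exp (of_int (zorder g \<rho>) * Ln (b \<rho> s)))"
        using fS by (simp add: P_def exp_add exp_sum)
      also have "(\<Prod>\<rho>\<in>S. exp (of_int (zorder g \<rho>) * Ln (b \<rho> s))) = (\<Prod>\<rho>\<in>S. b \<rho> s powi zorder g \<rho>)"
        by (rule prod.cong) (use b_np that in \<open>auto simp flip: exp_power_int simp: mult.commute\<close>)
      finally show ?thesis by (simp add: norm_mult prod_norm[symmetric] norm_power_int)
    qed
    have norm_g: "norm (g s) = norm (exp (p s)) * (\<Prod>\<rho>\<in>S. norm (s - \<rho>) powi zorder g \<rho>)"
      if "norm s \<le> R" "s \<notin> divisor" for s
      using p(2)[of s] that R2 by (simp add: norm_mult prod_norm[symmetric] norm_power_int)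
    have Re_P_circle: "Re (P (of_real R * cis \<theta>)) = ln (norm (g (of_real R * cis \<theta>)))" for \<theta>
    proof -
      define w where "w = of_real R * cis \<theta>"
      have nw: "norm w = R" using Rpos by (simp add: w_def norm_mult)
      then have wD: "w \<notin> divisor" using gen by auto
      have "norm (b \<rho> w) = norm (w - \<rho>)" for \<rho>
      proof -
        have "b \<rho> w * of_real R = w * (cnj w - cnj \<rho>)"
        proof -
          have "w * cnj w = of_real (R\<^sup>2)" using nw by (simp flip: complex_norm_square)
          then show ?thesis using Rpos by (simp add: b_def field_simps power2_eq_square)
        qed
        then have "norm (b \<rho> w) * R = R * norm (w - \<rho>)"
          using Rpos nw by (metis abs_of_pos complex_cnj_diff complex_mod_cnj norm_mult norm_of_real)
        then show ?thesis using Rpos by simp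
      qed
      then have "exp (Re (P w)) = norm (g w)"
        using norm_exp_P[of w] norm_g[of w] nw wD by simp
      then show ?thesis unfolding w_def[symmetric] by (metis ln_exp)
    qed
    \<comment> \<open>The positive part of ln |g| on the circle is what the proximity function
      averages; it is at most the characteristic, and \<open>2 * pi \<le> 7\<close>.\<close>
    have A: "integral {0..2*pi} (\<lambda>\<theta>. max 0 (Re (P (of_real R * cis \<theta>)))) \<le> 7 * R ^ N"
    proof -
      have "integral {0..2*pi} (\<lambda>\<theta>. max 0 (Re (P (of_real R * cis \<theta>)))) = 2 * pi * nev_m g R"
        unfolding Re_P_circle nev_m_def by simp
      also have "\<dots> \<le> 2 * pi * R ^ N"
        using R1[OF Rb(1)] nev_N_nonneg[of R] Rb by (intro mult_left_mono) (auto simp: nev_T_def)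
      also have "\<dots> \<le> 7 * R ^ N" using pi_less_4 pi_approx Rpos by (intro mult_right_mono) auto
      finally show ?thesis .
    qed
    have S_sum: "(\<Sum>\<rho>\<in>S. \<bar>real_of_int (zorder g \<rho>)\<bar>) \<le> 4 * R\<^sup>2 * V"
    proof -
      have "(\<Sum>\<rho>\<in>S. \<bar>real_of_int (zorder g \<rho>)\<bar>) \<le> (1 + R)\<^sup>2 * V"
        using divisor_count_le[OF summ, of R] Rpos by (simp add: divisor_count_def S_def V_def)
      also have "\<dots> \<le> (2 * R)\<^sup>2 * V" using Rb V by (intro mult_right_mono power_mono) auto
      finally show ?thesis by (simp add: power_mult_distrib)
    qed
    \<comment> \<open>Re P and ln |g| differ at c by the sum of
      \<open>ln |b| - ln |c - \<rho>|\<close> with multiplicities. All these moduli lie between 1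
      and 2 R, since c keeps a distance from the divisor, so each difference is at most 2 R; there
      are at most \<open>4 R^2 V\<close> terms.\<close>
    have Pc: "- Re (P (of_real c)) \<le> a + 8 * R ^ 3 * V"
    proof -
      have nc: "norm (complex_of_real c) \<le> R" using c Rb by simp
      have bc: "R / 2 \<le> norm (b \<rho> (of_real c))" "norm (b \<rho> (of_real c)) \<le> 2 * R" if "\<rho> \<in> S" for \<rho>
      proof -
        have "norm (b \<rho> (of_real c) - of_real R) \<le> c" using b_dist[OF that, of "of_real c"] c by simp
        then show "R / 2 \<le> norm (b \<rho> (of_real c))" "norm (b \<rho> (of_real c)) \<le> 2 * R"
          using norm_triangle_ineq2[of "of_real R" "b \<rho> (of_real c)"] norm_triangle_ineq2[of "b \<rho> (of_real c)" "of_real R"] Rb c Rpos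
          by (auto simp: norm_minus_commute)
      qed
      have cr: "1 \<le> norm (of_real c - \<rho>)" "norm (of_real c - \<rho>) \<le> 2 * R" if "\<rho> \<in> S" for \<rho>
      proof -
        have "\<rho> \<in> divisor" using that by (simp add: S_def)
        then show "1 \<le> norm (of_real c - \<rho>)"
          using c(2)[of \<rho>] complex_Re_le_cmod[of "of_real c - \<rho>"] by simp
        show "norm (of_real c - \<rho>) \<le> 2 * R"
          using norm_triangle_ineq4[of "of_real c" \<rho>] S_ball[OF that] nc by simp
      qed
      have ln_bd: "0 \<le> ln x \<and> ln x \<le> 2 * R" if "1 \<le> x" "x \<le> 2 * R" for x
        using that ln_le_minus_one[of x] ln_ge_zero[of x] by linarith
      have pos: "0 < norm (b \<rho> (of_real c))" "0 < norm (of_real c - \<rho>)" if "\<rho> \<in> S" for \<rho>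
        using bc[OF that] cr[OF that] Rpos by linarith+
      have e1: "Re (P (of_real c)) = Re (p (of_real c)) + (\<Sum>\<rho>\<in>S. of_int (zorder g \<rho>) * ln (norm (b \<rho> (of_real c))))"
      proof -
        have "Re (P (of_real c)) = ln (exp (Re (P (of_real c))))" by simp
        also have "\<dots> = ln (exp (Re (p (of_real c)))) + ln (\<Prod>\<rho>\<in>S. norm (b \<rho> (of_real c)) powi zorder g \<rho>)"
          unfolding norm_exp_P[OF nc] norm_exp_eq_Re
          by (rule ln_mult_pos) (use pos in \<open>auto intro!: prod_pos zero_less_power_int\<close>)
        also have "ln (\<Prod>\<rho>\<in>S. norm (b \<rho> (of_real c)) powi zorder g \<rho>) =
            (\<Sum>\<rho>\<in>S. ln (norm (b \<rho> (of_real c)) powi zorder g \<rho>))"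
          using fS by (rule ln_prod) (use pos in \<open>auto intro!: zero_less_power_int\<close>)
        also have "\<dots> = (\<Sum>\<rho>\<in>S. of_int (zorder g \<rho>) * ln (norm (b \<rho> (of_real c))))"
          by (rule sum.cong) (use pos in \<open>auto simp: ln_power_int\<close>)
        finally show ?thesis by simp
      qed
      have e2: "ln (norm (g (of_real c))) = Re (p (of_real c)) + (\<Sum>\<rho>\<in>S. of_int (zorder g \<rho>) * ln (norm (of_real c - \<rho>)))"
      proof -
        have "ln (norm (g (of_real c))) = ln (exp (Re (p (of_real c)))) + ln (\<Prod>\<rho>\<in>S. norm (of_real c - \<rho>) powi zorder g \<rho>)"
          unfolding norm_g[OF nc cD] norm_exp_eq_Re
          by (rule ln_mult_pos) (use pos in \<open>auto intro!: prod_pos zero_less_power_int\<close>)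
        also have "ln (\<Prod>\<rho>\<in>S. norm (of_real c - \<rho>) powi zorder g \<rho>) =
            (\<Sum>\<rho>\<in>S. ln (norm (of_real c - \<rho>) powi zorder g \<rho>))"
          using fS by (rule ln_prod) (use pos in \<open>auto intro!: zero_less_power_int\<close>)
        also have "\<dots> = (\<Sum>\<rho>\<in>S. of_int (zorder g \<rho>) * ln (norm (of_real c - \<rho>)))"
          by (rule sum.cong) (use pos in \<open>auto simp: ln_power_int\<close>)
        finally show ?thesis by simp
      qed
      have "\<bar>Re (P (of_real c)) - ln (norm (g (of_real c)))\<bar> \<le>
         (\<Sum>\<rho>\<in>S. \<bar>real_of_int (zorder g \<rho>) * (ln (norm (b \<rho> (of_real c))) - ln (norm (of_real c - \<rho>)))\<bar>)"
        unfolding e1 e2 by (simp add: right_diff_distrib sum_subtractf[symmetric])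
      also have "\<dots> \<le> (\<Sum>\<rho>\<in>S. \<bar>real_of_int (zorder g \<rho>)\<bar> * (2 * R))"
      proof (rule sum_mono)
        fix \<rho> assume \<rho>: "\<rho> \<in> S"
        have "1 \<le> norm (b \<rho> (of_real c))" using bc[OF \<rho>] Rb by linarith
        then have "\<bar>ln (norm (b \<rho> (of_real c))) - ln (norm (of_real c - \<rho>))\<bar> \<le> 2 * R"
          using ln_bd[OF _ bc(2)[OF \<rho>]] ln_bd[OF cr[OF \<rho>]] by linarith
        then show "\<bar>real_of_int (zorder g \<rho>) * (ln (norm (b \<rho> (of_real c))) - ln (norm (of_real c - \<rho>)))\<bar>
            \<le> \<bar>real_of_int (zorder g \<rho>)\<bar> * (2 * R)"
          unfolding abs_mult by (intro mult_left_mono) auto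
      qed
      also have "\<dots> = (\<Sum>\<rho>\<in>S. \<bar>real_of_int (zorder g \<rho>)\<bar>) * (2 * R)" by (simp add: sum_distrib_right)
      also have "\<dots> \<le> 4 * R\<^sup>2 * V * (2 * R)" using S_sum Rpos by (intro mult_right_mono) auto
      also have "\<dots> = 8 * R ^ 3 * V" by (simp add: power2_eq_square power3_eq_cube)
      finally show ?thesis unfolding a_def by linarith
    qed
    have "norm (q s) \<le> C * R ^ (N + 3)" if s: "norm s \<le> R / 2" for s
    proof -
      have ge1: "1 \<le> R ^ k" for k using Rb by (intro one_le_power) auto
      have a0: "0 \<le> a" by (simp add: a_def)
      have "norm (P2 s) \<le> 96 / R\<^sup>2 * (7 * R ^ N + max 0 (- Re (P (of_real c))))"
        using second_derivative_bound[OF Rpos P_cont P_hol s _ A, of "of_real c"] P_dd[of s] s c Rb Rpos by simp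
      also have "\<dots> \<le> 96 * (7 * R ^ N + (a + 8 * R ^ 3 * V))"
      proof (rule mult_mono)
        have "1 \<le> R\<^sup>2" by (rule ge1)
        then show "96 / R\<^sup>2 \<le> 96" by (simp add: divide_le_eq)
        show "7 * R ^ N + max 0 (- Re (P (of_real c))) \<le> 7 * R ^ N + (a + 8 * R ^ 3 * V)"
          using Pc a0 V Rpos by simp
      qed (use Rpos in auto)
      also have "\<dots> \<le> 96 * (7 * R ^ (N + 3) + (a * R ^ (N + 3) + 8 * R ^ (N + 3) * V))"
      proof -
        have "R ^ N \<le> R ^ (N + 3)" "R ^ 3 \<le> R ^ (N + 3)" using Rb by (auto intro!: power_increasing)
        moreover have "a * 1 \<le> a * R ^ (N + 3)" using a0 by (intro mult_left_mono ge1)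
        ultimately show ?thesis using V by (intro mult_left_mono add_mono mult_right_mono) auto
      qed
      finally have b1: "norm (P2 s) \<le> 96 * (7 + a + 8 * V) * R ^ (N + 3)" by (simp add: algebra_simps)
      \<comment> \<open>To return from P to p, the terms of the reflected points are added back.
        Since \<open>|\<rho>| \<le> R\<close> and \<open>|b| \<ge> R / 2\<close>, each is at most
        \<open>4 / R^2\<close>, and \<open>4 R^2 V\<close> of them give \<open>16 V\<close>.\<close>
      have "norm (\<Sum>\<rho>\<in>S. of_int (zorder g \<rho>) * (cnj \<rho> / of_real R)\<^sup>2 / (b \<rho> s)\<^sup>2)
          \<le> (\<Sum>\<rho>\<in>S. \<bar>real_of_int (zorder g \<rho>)\<bar> * (4 / R\<^sup>2))"
      proof (rule sum_norm_le)
        fix \<rho> assume \<rho>: "\<rho> \<in> S"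
        have "norm (cnj \<rho> / of_real R) \<le> 1" using S_ball[OF \<rho>] Rpos by (simp add: norm_divide)
        then have n1: "norm ((cnj \<rho> / of_real R)\<^sup>2) \<le> 1" by (simp add: norm_power power_le_one)
        have "R / 2 \<le> norm (b \<rho> s)"
          using b_dist[OF \<rho>, of s] s Rpos norm_triangle_ineq2[of "of_real R" "b \<rho> s"] by (simp add: norm_minus_commute)
        then have "(R / 2)\<^sup>2 \<le> (norm (b \<rho> s))\<^sup>2" using Rpos by (intro power_mono) auto
        then have n2: "R\<^sup>2 / 4 \<le> norm ((b \<rho> s)\<^sup>2)" by (simp add: norm_power power_divide)
        have "norm ((cnj \<rho> / of_real R)\<^sup>2) / norm ((b \<rho> s)\<^sup>2) \<le> 1 / (R\<^sup>2 / 4)"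
          using n1 n2 Rpos by (intro frac_le) auto
        then have "\<bar>real_of_int (zorder g \<rho>)\<bar> * (norm ((cnj \<rho> / of_real R)\<^sup>2) / norm ((b \<rho> s)\<^sup>2))
           \<le> \<bar>real_of_int (zorder g \<rho>)\<bar> * (4 / R\<^sup>2)" by (intro mult_left_mono) auto
        then show "norm (of_int (zorder g \<rho>) * (cnj \<rho> / of_real R)\<^sup>2 / (b \<rho> s)\<^sup>2)
            \<le> \<bar>real_of_int (zorder g \<rho>)\<bar> * (4 / R\<^sup>2)" by (simp add: norm_mult norm_divide)
      qed
      also have "\<dots> = (\<Sum>\<rho>\<in>S. \<bar>real_of_int (zorder g \<rho>)\<bar>) * (4 / R\<^sup>2)" by (simp only: sum_distrib_right)
      also have "\<dots> \<le> (4 * R\<^sup>2 * V) * (4 / R\<^sup>2)" using S_sum by (intro mult_right_mono) auto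
      also have "\<dots> = 16 * V * 1" using Rpos by simp
      also have "\<dots> \<le> 16 * V * R ^ (N + 3)" using V by (intro mult_left_mono ge1) auto
      finally have b2: "norm (\<Sum>\<rho>\<in>S. of_int (zorder g \<rho>) * (cnj \<rho> / of_real R)\<^sup>2 / (b \<rho> s)\<^sup>2) \<le> 16 * V * R ^ (N + 3)" .
      have "q s = P2 s + (\<Sum>\<rho>\<in>S. of_int (zorder g \<rho>) * (cnj \<rho> / of_real R)\<^sup>2 / (b \<rho> s)\<^sup>2)"
        by (simp add: P2_def)
      then have "norm (q s) \<le> 96 * (7 + a + 8 * V) * R ^ (N + 3) + 16 * V * R ^ (N + 3)"
        using b1 b2 norm_triangle_ineq by (smt (verit))
      then show ?thesis by (simp add: C_def algebra_simps)
    qed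
    moreover have "q s = deriv logderiv s + (\<Sum>\<rho>\<in>S. of_int (zorder g \<rho>) / (s - \<rho>)\<^sup>2)" if s: "s \<in> ball 0 R - divisor" for s
    proof -
      \<comment> \<open>Logarithmic differentiation of the factorization needs it on an open set
        around s, so the finitely many points of S are removed from the larger disc.\<close>
      define U where "U = ball 0 R2 - S"
      have U: "open U" unfolding U_def using fS by (intro open_Diff finite_imp_closed) auto
      have UD: "z \<in> ball 0 R2 - divisor" if "z \<in> U" for z using that R2 unfolding U_def by auto
      have FU: "logderiv z = p1 z + (\<Sum>\<rho>\<in>S. of_int (zorder g \<rho>) / (z - \<rho>))" if z: "z \<in> U" for z
      proof -
        define Q where "Q = (\<lambda>s. \<Prod>\<rho>\<in>S. (s - \<rho>) powi zorder g \<rho>)"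
        have nz: "z - \<rho> \<noteq> 0" if "\<rho> \<in> S" for \<rho> using z that by (auto simp: U_def)
        have dQ: "(Q has_field_derivative Q z * (\<Sum>\<rho>\<in>S. of_int (zorder g \<rho>) * (z - \<rho>) powi (zorder g \<rho> - 1) * 1 / (z - \<rho>) powi zorder g \<rho>)) (at z)"
          unfolding Q_def by (rule has_field_derivative_prod') (use nz in \<open>auto intro!: derivative_eq_intros\<close>)
        have "(\<Sum>\<rho>\<in>S. of_int (zorder g \<rho>) * (z - \<rho>) powi (zorder g \<rho> - 1) * 1 / (z - \<rho>) powi zorder g \<rho>) =
              (\<Sum>\<rho>\<in>S. of_int (zorder g \<rho>) / (z - \<rho>))" (is "_ = ?T")
          by (rule sum.cong) (use nz in \<open>auto simp: power_int_diff\<close>)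
        with dQ have dQ': "(Q has_field_derivative Q z * ?T) (at z)" by simp
        have "((\<lambda>s. Q s * exp (p s)) has_field_derivative Q z * ?T * exp (p z) + exp (p z) * p1 z * Q z) (at z)"
          using UD[OF z] by (intro DERIV_mult dQ' DERIV_chain2[OF DERIV_exp] dp(1)) auto
        then have "(g has_field_derivative Q z * ?T * exp (p z) + exp (p z) * p1 z * Q z) (at z)"
        proof (rule has_field_derivative_transform_within_open[OF _ U z])
          show "Q x * exp (p x) = g x" if "x \<in> U" for x using p(2)[OF UD[OF that]] by (simp add: Q_def)
        qed
        then have "deriv g z = Q z * exp (p z) * (p1 z + ?T)"
          by (simp add: DERIV_imp_deriv algebra_simps)
        moreover have "g z = Q z * exp (p z)" using p(2)[OF UD[OF z]] by (simp add: Q_def)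
        moreover have "g z \<noteq> 0" using regular(2) UD[OF z] by auto
        ultimately show ?thesis by (simp add: logderiv_def)
      qed
      have sU: "s \<in> U" using s R2 by (auto simp: U_def)
      have ds: "((\<lambda>z. of_int (zorder g \<rho>) / (z - \<rho>)) has_field_derivative - of_int (zorder g \<rho>) / (s - \<rho>)\<^sup>2) (at s)"
        if "\<rho> \<in> S" for \<rho>
        using that sU by (auto intro!: derivative_eq_intros simp: U_def power2_eq_square)
      have "((\<lambda>z. p1 z + (\<Sum>\<rho>\<in>S. of_int (zorder g \<rho>) / (z - \<rho>))) has_field_derivative
          q s + (\<Sum>\<rho>\<in>S. - of_int (zorder g \<rho>) / (s - \<rho>)\<^sup>2)) (at s)"
        using sU by (intro DERIV_add DERIV_sum dp(2) ds) (auto simp: U_def)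
      then have "(logderiv has_field_derivative q s + (\<Sum>\<rho>\<in>S. - of_int (zorder g \<rho>) / (s - \<rho>)\<^sup>2)) (at s)"
        by (rule has_field_derivative_transform_within_open[OF _ U sU]) (simp add: FU)
      then show ?thesis by (simp add: DERIV_imp_deriv sum_negf)
    qed
    moreover have "q holomorphic_on ball 0 R" by (rule holomorphic_on_subset[OF q]) (use R2 in auto)
    ultimately show "\<exists>q. q holomorphic_on ball 0 R \<and> (\<forall>s. norm s \<le> R / 2 \<longrightarrow> norm (q s) \<le> C * R ^ (N + 3)) \<and>
        (\<forall>s \<in> ball 0 R - divisor. q s = deriv logderiv s + (\<Sum>\<rho>\<in>divisor \<inter> cball 0 R. of_int (zorder g \<rho>) / (s - \<rho>)\<^sup>2))"
      unfolding S_def by blast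
  qed
qed

end

section \<open>Expansion of the derivative of the logarithmic derivative\<close>

context nonconstant_meromorphic
begin

definition tail :: "real \<Rightarrow> real" where "tail Y = infsum weight {\<rho>. Y < norm \<rho>}"

lemma tail_tendsto_0:
  assumes summ: "weight summable_on UNIV"
  shows "(tail \<longlongrightarrow> 0) at_top"
proof (rule tendstoI)
  fix e :: real assume e: "0 < e"
  obtain X where X: "finite X" "dist (sum weight X) (infsum weight UNIV) \<le> e / 2"
    using infsum_finite_approximation[OF summ, of "e / 2"] e by auto
  obtain B where B: "\<And>x. x \<in> X \<Longrightarrow> norm x \<le> B"
    using finite_imp_bounded[OF X(1)] unfolding bounded_iff by blast
  have sub: "weight summable_on A" for A by (rule summable_on_subset[OF summ]) auto
  show "\<forall>\<^sub>F Y in at_top. dist (tail Y) 0 < e"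
    using eventually_ge_at_top[of B]
  proof eventually_elim
    case (elim Y)
    have "tail Y \<le> infsum weight (UNIV - X)"
      unfolding tail_def by (rule infsum_mono2[OF sub sub]) (use B elim in \<open>force simp: weight_nonneg\<close>)+
    also have "\<dots> = infsum weight UNIV - sum weight X"
      using infsum_Un_disjoint[OF sub sub, of X "UNIV - X"] X(1) by simp
    also have "\<dots> \<le> e / 2" using X(2) unfolding dist_real_def by linarith
    finally have "tail Y < e" using e by simp
    moreover have "0 \<le> tail Y" unfolding tail_def by (intro infsum_nonneg weight_nonneg)
    ultimately show ?case by simp
  qed
qed

text \<open>The factor k compares \<open>1 + |\<rho>|\<close> with \<open>|s - \<rho>|\<close>, so
  every far term is at most \<open>k^2\<close> times its weight. It is left free because two regimes
  occur: 4 when s lies well inside the disc of radius Y, and a constant uniform in s along the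
  positive reals.\<close>

lemma pole_series_split:
  assumes summ: "weight summable_on UNIV" and k: "\<And>\<rho>. \<rho> \<in> divisor \<Longrightarrow> Y < norm \<rho> \<Longrightarrow> 1 + norm \<rho> \<le> k * norm (s - \<rho>)"
  shows "norm ((\<Sum>\<^sub>\<infinity>\<rho>. of_int (zorder g \<rho>) / (s - \<rho>)\<^sup>2) - (\<Sum>\<rho>\<in>divisor \<inter> cball 0 Y. of_int (zorder g \<rho>) / (s - \<rho>)\<^sup>2))
     \<le> k\<^sup>2 * tail Y"
proof -
  define f where "f = (\<lambda>\<rho>. of_int (zorder g \<rho>) / (s - \<rho>)\<^sup>2)"
  let ?B = "{\<rho>. Y < norm \<rho>}"
  have f0: "f \<rho> = 0" if "\<rho> \<notin> divisor" for \<rho> using that by (simp add: f_def divisor_def)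
  have bd: "norm (f \<rho>) \<le> k\<^sup>2 * weight \<rho>" if "\<rho> \<in> ?B" for \<rho>
  proof (cases "\<rho> \<in> divisor")
    case True
    have pos: "0 < 1 + norm \<rho>" using norm_ge_zero[of \<rho>] by linarith
    have le: "1 + norm \<rho> \<le> k * norm (s - \<rho>)" using k True that by auto
    then have nz: "s - \<rho> \<noteq> 0" using pos by auto
    have "(1 + norm \<rho>)\<^sup>2 \<le> (k * norm (s - \<rho>))\<^sup>2" using le pos by (intro power_mono) auto
    then have "1 / (norm (s - \<rho>))\<^sup>2 \<le> k\<^sup>2 / (1 + norm \<rho>)\<^sup>2"
      using nz pos by (simp add: field_simps power_mult_distrib)
    then have "\<bar>real_of_int (zorder g \<rho>)\<bar> * (1 / (norm (s - \<rho>))\<^sup>2) \<le> \<bar>real_of_int (zorder g \<rho>)\<bar> * (k\<^sup>2 / (1 + norm \<rho>)\<^sup>2)"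
      by (intro mult_left_mono) auto
    then show ?thesis by (simp add: f_def weight_def norm_divide norm_power mult.commute)
  qed (simp add: f0 weight_nonneg)
  have sub: "(\<lambda>\<rho>. k\<^sup>2 * weight \<rho>) summable_on ?B"
    by (intro summable_on_cmult_right summable_on_subset[OF summ]) auto
  have abs: "(\<lambda>\<rho>. norm (f \<rho>)) summable_on ?B"
    by (rule Infinite_Sum.abs_summable_on_comparison_test'[OF sub bd])
  have sB: "f summable_on ?B" by (rule abs_summable_summable[OF abs])
  have sA: "f summable_on (divisor \<inter> cball 0 Y)" by (rule summable_on_finite[OF finite_divisor])
  have "infsum f UNIV = infsum f ((divisor \<inter> cball 0 Y) \<union> ?B)"
    by (rule infsum_cong_neutral) (auto simp: f0)
  also have "\<dots> = (\<Sum>\<rho>\<in>divisor \<inter> cball 0 Y. f \<rho>) + infsum f ?B"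
  proof -
    have "(divisor \<inter> cball 0 Y) \<inter> ?B = {}" by auto
    from infsum_Un_disjoint[OF sA sB this] show ?thesis by (simp only: infsum_finite[OF finite_divisor])
  qed
  finally have "norm (infsum f UNIV - (\<Sum>\<rho>\<in>divisor \<inter> cball 0 Y. f \<rho>)) = norm (infsum f ?B)" by simp
  also have "\<dots> \<le> infsum (\<lambda>\<rho>. norm (f \<rho>)) ?B" by (rule norm_infsum_bound[OF abs])
  also have "\<dots> \<le> infsum (\<lambda>\<rho>. k\<^sup>2 * weight \<rho>) ?B" by (rule infsum_mono[OF abs sub bd])
  also have "\<dots> = k\<^sup>2 * tail Y" by (simp add: tail_def infsum_cmult_right')
  finally show ?thesis by (simp add: f_def)
qed

text \<open>Here \<open>|s - \<rho>| \<ge> |\<rho>| / 2\<close> and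
  \<open>1 + |\<rho>| \<le> 2 |\<rho>|\<close>, whence the constant 4.\<close>

lemma far_from_divisor:
  assumes "norm s \<le> Y / 2" "1 \<le> Y" "Y < norm \<rho>"
  shows "1 + norm \<rho> \<le> 4 * norm (s - \<rho>)"
  using assms norm_triangle_ineq2[of \<rho> s] norm_minus_commute[of \<rho> s] by linarith

text \<open>The tail is small uniformly in x, and each of the finitely many remaining terms tends to
  0.\<close>

lemma pole_series_tendsto_0:
  assumes summ: "weight summable_on UNIV" and c: "1 \<le> c" "\<And>z. z \<in> divisor \<Longrightarrow> Re z \<le> c - 2"
  shows "((\<lambda>x. \<Sum>\<^sub>\<infinity>\<rho>. of_int (zorder g \<rho>) / (of_real x - \<rho>)\<^sup>2) \<longlongrightarrow> 0) at_top"
proof (rule tendstoI)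
  fix e :: real assume e: "0 < e"
  define k where "k = 2 + c"
  \<comment> \<open>From \<open>|\<rho>| \<le> |c - \<rho>| + c\<close> and
    \<open>|c - \<rho>| \<ge> 1\<close> the estimate holds at x = c with k = 2 + c; moving to the
    right only increases the distance to \<rho>.\<close>
  have k: "1 + norm \<rho> \<le> k * norm (of_real x - \<rho>)" if "\<rho> \<in> divisor" "c \<le> x" for \<rho> x
  proof -
    have R: "1 \<le> Re (of_real c - \<rho>)" using c(2)[OF that(1)] by simp
    then have ge: "1 \<le> norm (of_real c - \<rho>)" using complex_Re_le_cmod[of "of_real c - \<rho>"] by linarith
    have "norm \<rho> \<le> norm (of_real c - \<rho>) + norm (complex_of_real c)"
      using norm_triangle_ineq4[of "of_real c" "of_real c - \<rho>"] by simp
    then have "1 + norm \<rho> \<le> (1 + c) + norm (of_real c - \<rho>)" using c by simp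
    also have "\<dots> \<le> (1 + c) * norm (of_real c - \<rho>) + norm (of_real c - \<rho>)"
      using ge c mult_left_mono[OF ge, of "1 + c"] by simp
    also have "\<dots> = k * norm (of_real c - \<rho>)" by (simp add: k_def algebra_simps)
    also have "\<dots> \<le> k * norm (of_real x - \<rho>)"
    proof (rule mult_left_mono)
      have "(Re (of_real c - \<rho>))\<^sup>2 \<le> (Re (of_real x - \<rho>))\<^sup>2" using R that by (intro power_mono) auto
      then have "(norm (of_real c - \<rho>))\<^sup>2 \<le> (norm (of_real x - \<rho>))\<^sup>2" by (simp add: cmod_power2)
      then show "norm (of_real c - \<rho>) \<le> norm (of_real x - \<rho>)" by (rule power2_le_imp_le) simp
    qed (use c in \<open>simp add: k_def\<close>)
    finally show ?thesis .
  qed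
  have "((\<lambda>Y. k\<^sup>2 * tail Y) \<longlongrightarrow> k\<^sup>2 * 0) at_top" by (intro tendsto_intros tail_tendsto_0 summ)
  then have "\<forall>\<^sub>F Y in at_top. k\<^sup>2 * tail Y < e / 2" using e by (intro order_tendstoD(2)) auto
  then obtain Y where Y: "k\<^sup>2 * tail Y < e / 2" by (auto simp: eventually_at_top_linorder)
  have "((\<lambda>x. \<Sum>\<rho>\<in>divisor \<inter> cball 0 Y. of_int (zorder g \<rho>) / (of_real x - \<rho>)\<^sup>2) \<longlongrightarrow> (\<Sum>\<rho>\<in>divisor \<inter> cball 0 Y. 0)) at_top"
  proof (rule tendsto_sum)
    fix \<rho>
    have "filterlim (\<lambda>x. complex_of_real x + (- \<rho>)) at_infinity at_top"
      by (intro tendsto_add_filterlim_at_infinity'[OF _ tendsto_const] filterlim_compose[OF filterlim_of_real_at_infinity] filterlim_at_top_imp_at_infinity filterlim_ident)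
    then have "filterlim (\<lambda>x. (complex_of_real x + (- \<rho>))\<^sup>2) at_infinity at_top"
      by (rule Limits.filterlim_power_at_infinity) simp
    then have "filterlim (\<lambda>x. (complex_of_real x - \<rho>)\<^sup>2) at_infinity at_top" by simp
    then show "((\<lambda>x. of_int (zorder g \<rho>) / (complex_of_real x - \<rho>)\<^sup>2) \<longlongrightarrow> 0) at_top"
      by (intro tendsto_divide_0[OF tendsto_const])
  qed
  then have "\<forall>\<^sub>F x in at_top. norm (\<Sum>\<rho>\<in>divisor \<inter> cball 0 Y. of_int (zorder g \<rho>) / (complex_of_real x - \<rho>)\<^sup>2) < e / 2"
    using e by (auto dest!: tendstoD[where e = "e / 2"])
  with eventually_ge_at_top[of c]
  show "\<forall>\<^sub>F x in at_top. dist (\<Sum>\<^sub>\<infinity>\<rho>. of_int (zorder g \<rho>) / (complex_of_real x - \<rho>)\<^sup>2) 0 < e"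
  proof eventually_elim
    case (elim x)
    have "norm (\<Sum>\<^sub>\<infinity>\<rho>. of_int (zorder g \<rho>) / (complex_of_real x - \<rho>)\<^sup>2) \<le>
       norm ((\<Sum>\<^sub>\<infinity>\<rho>. of_int (zorder g \<rho>) / (of_real x - \<rho>)\<^sup>2) - (\<Sum>\<rho>\<in>divisor \<inter> cball 0 Y. of_int (zorder g \<rho>) / (of_real x - \<rho>)\<^sup>2))
       + norm (\<Sum>\<rho>\<in>divisor \<inter> cball 0 Y. of_int (zorder g \<rho>) / (of_real x - \<rho>)\<^sup>2)"
      using norm_triangle_sub[of "\<Sum>\<^sub>\<infinity>\<rho>. of_int (zorder g \<rho>) / (complex_of_real x - \<rho>)\<^sup>2"] by (simp add: add.commute)
    also have "\<dots> < e / 2 + e / 2"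
      using pole_series_split[OF summ, of Y k "of_real x"] k elim Y by (intro add_le_less_mono) auto
    finally show ?case by simp
  qed
qed

text \<open>Only finitely many radii in a bounded interval are moduli of zeros or poles. The Poisson
  argument on a circle requires the circle to avoid them.\<close>

lemma generic_radius:
  obtains R where "x \<le> R" "divisor \<inter> sphere 0 R = {}"
proof -
  have "finite (norm ` (divisor \<inter> cball 0 (x + 1)))" using finite_divisor by auto
  moreover have "infinite {x..x + 1}" by (simp add: infinite_Icc)
  ultimately obtain R where R: "R \<in> {x..x + 1}" "R \<notin> norm ` (divisor \<inter> cball 0 (x + 1))"
    by (meson finite_subset subsetI)
  have "z \<notin> divisor" if "norm z = R" for z
    using R that by auto
  then have "divisor \<inter> sphere 0 R = {}" by auto
  then show ?thesis using R that[of R] by auto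
qed

text \<open>A Liouville argument on a half-plane: W is a locally uniform limit of functions
  \<open>q n\<close> that are holomorphic on whole discs of radius \<open>R n\<close> and bounded
  there by a fixed power of \<open>R n\<close> at half the radius. Cauchy's inequality around a
  fixed point then uses the large discs, which the half-plane itself would not contain.\<close>

lemma deriv_log_derivative_series:
  assumes summ: "weight summable_on UNIV" and ord: "nev_order g < \<infinity>"
    and c: "1 \<le> c" "\<And>z. z \<in> divisor \<Longrightarrow> Re z \<le> c - 2"
    and lim: "((\<lambda>x. deriv logderiv (of_real x)) \<longlongrightarrow> 0) at_top"
    and s: "c - 1 < Re s"
  shows "deriv logderiv s = - (\<Sum>\<^sub>\<infinity>\<rho>. of_int (zorder g \<rho>) / (s - \<rho>)\<^sup>2)"
proof -
  define E where "E = (\<lambda>s. \<Sum>\<^sub>\<infinity>\<rho>. of_int (zorder g \<rho>) / (s - \<rho>)\<^sup>2)"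
  define W where "W = (\<lambda>s. deriv logderiv s + E s)"
  define \<Omega> where "\<Omega> = {s. c - 1 < Re s}"
  have \<Omega>: "open \<Omega>" "convex \<Omega>" unfolding \<Omega>_def by (simp_all add: open_halfspace_Re_gt convex_halfspace_Re_gt)
  have \<Omega>divisor: "z \<notin> divisor" if "z \<in> \<Omega>" for z using c(2)[of z] that by (auto simp: \<Omega>_def)
  obtain M C R0 where MC: "0 \<le> C" "1 \<le> R0"
    "\<And>R. R0 \<le> R \<Longrightarrow> divisor \<inter> sphere 0 R = {} \<Longrightarrow>
      \<exists>q. q holomorphic_on ball 0 R \<and> (\<forall>s. norm s \<le> R / 2 \<longrightarrow> norm (q s) \<le> C * R ^ M) \<and>
        (\<forall>s \<in> ball 0 R - divisor. q s = deriv logderiv s + (\<Sum>\<rho>\<in>divisor \<inter> cball 0 R. of_int (zorder g \<rho>) / (s - \<rho>)\<^sup>2))"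
    using log_derivative_growth[OF summ ord c] by blast
  have "\<exists>R. \<forall>n::nat. R0 + real n \<le> R n \<and> divisor \<inter> sphere 0 (R n) = {}"
    by (rule choice) (meson generic_radius)
  then obtain R where R: "\<And>n::nat. R0 + real n \<le> R n" "\<And>n. divisor \<inter> sphere 0 (R n) = {}" by blast
  have R_R0: "R0 \<le> R n" for n using R(1)[of n] by linarith
  have R_lim: "filterlim R at_top sequentially"
  proof (rule filterlim_at_top_mono[OF filterlim_real_sequentially])
    show "\<forall>\<^sub>F n in sequentially. real n \<le> R n"
      using R(1) MC(2) by (intro always_eventually allI) (smt (verit))
  qed
  have "\<exists>q. \<forall>n. q n holomorphic_on ball 0 (R n) \<and> (\<forall>s. norm s \<le> R n / 2 \<longrightarrow> norm (q n s) \<le> C * R n ^ M) \<and>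
        (\<forall>s \<in> ball 0 (R n) - divisor. q n s = deriv logderiv s + (\<Sum>\<rho>\<in>divisor \<inter> cball 0 (R n). of_int (zorder g \<rho>) / (s - \<rho>)\<^sup>2))"
    by (rule choice) (use MC(3)[OF R_R0 R(2)] in blast)
  then obtain q where q: "\<And>n. q n holomorphic_on ball 0 (R n)"
      "\<And>n s. norm s \<le> R n / 2 \<Longrightarrow> norm (q n s) \<le> C * R n ^ M"
      "\<And>n s. s \<in> ball 0 (R n) - divisor \<Longrightarrow> q n s = deriv logderiv s + (\<Sum>\<rho>\<in>divisor \<inter> cball 0 (R n). of_int (zorder g \<rho>) / (s - \<rho>)\<^sup>2)"
    by blast
  have R_big: "\<forall>\<^sub>F n in sequentially. X \<le> R n" for X
    using R_lim by (simp add: filterlim_at_top)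
  \<comment> \<open>The difference between W and \<open>q n\<close> is exactly the part of the
    series beyond radius \<open>R n\<close>.\<close>
  have ul: "uniform_limit (\<Omega> \<inter> ball 0 X) q W sequentially" for X
  proof (rule uniform_limitI)
    fix e :: real assume e: "0 < e"
    have "((\<lambda>n. 4\<^sup>2 * tail (R n)) \<longlongrightarrow> 4\<^sup>2 * 0) sequentially"
      by (intro tendsto_intros filterlim_compose[OF tail_tendsto_0[OF summ] R_lim])
    then have "\<forall>\<^sub>F n in sequentially. 4\<^sup>2 * tail (R n) < e" using e by (intro order_tendstoD(2)) auto
    with R_big[of "2 * X"] show "\<forall>\<^sub>F n in sequentially. \<forall>s\<in>\<Omega> \<inter> ball 0 X. dist (q n s) (W s) < e"
    proof eventually_elim
      case (elim n)
      show ?case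
      proof
        fix s assume s: "s \<in> \<Omega> \<inter> ball 0 X"
        then have sn: "norm s \<le> R n / 2" using elim by auto
        have R1: "1 \<le> R n" using R_R0[of n] MC by linarith
        have "s \<in> ball 0 (R n) - divisor" using sn R1 \<Omega>divisor s by auto
        then have "W s - q n s = E s - (\<Sum>\<rho>\<in>divisor \<inter> cball 0 (R n). of_int (zorder g \<rho>) / (s - \<rho>)\<^sup>2)"
          using q(3) by (simp add: W_def)
        moreover have "norm (E s - (\<Sum>\<rho>\<in>divisor \<inter> cball 0 (R n). of_int (zorder g \<rho>) / (s - \<rho>)\<^sup>2)) \<le> 4\<^sup>2 * tail (R n)"
          unfolding E_def by (rule pole_series_split[OF summ]) (rule far_from_divisor[OF sn R1])
        ultimately have "norm (W s - q n s) < e" using elim by simp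
        then show "dist (q n s) (W s) < e" by (simp add: dist_norm norm_minus_commute)
      qed
    qed
  qed
  have qh: "\<forall>\<^sub>F n in sequentially. q n holomorphic_on (\<Omega> \<inter> ball 0 X)" for X
    using R_big[of X] by eventually_elim (auto intro!: holomorphic_on_subset[OF q(1)])
  \<comment> \<open>Holomorphy is inherited from the uniform limit on small discs, so the infinite
    series is never differentiated term by term.\<close>
  have W_hol: "W holomorphic_on \<Omega>"
  proof -
    have "\<exists>f'. (W has_field_derivative f') (at z)" if z: "z \<in> \<Omega>" for z
    proof -
      define A where "A = \<Omega> \<inter> ball 0 (norm z + 1)"
      have "open A" "z \<in> A" using \<Omega> z by (auto simp: A_def)
      then obtain d where d: "0 < d" "cball z d \<subseteq> A" by (meson open_contains_cball)
      have "W holomorphic_on ball z d"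
      proof (rule holomorphic_uniform_limit)
        show "uniform_limit (cball z d) q W sequentially"
          using uniform_limit_on_subset[OF ul] d unfolding A_def by blast
        show "\<forall>\<^sub>F n in sequentially. continuous_on (cball z d) (q n) \<and> q n holomorphic_on ball z d"
          using qh[of "norm z + 1"] unfolding A_def[symmetric]
        proof eventually_elim
          case (elim n)
          have "ball z d \<subseteq> A" using d(2) by auto
          then show ?case
            using elim d(2) by (meson holomorphic_on_imp_continuous_on holomorphic_on_subset continuous_on_subset)
        qed
      qed auto
      then show ?thesis using d(1) by (meson centre_in_ball holomorphic_on_open open_ball)
    qed
    then show ?thesis using holomorphic_on_open[OF \<Omega>(1)] by blast
  qed
  \<comment> \<open>On a disc of radius \<open>R n / 4\<close>, Cauchy's inequality gains
    \<open>R n ^ Suc M\<close> against growth \<open>R n ^ M\<close>, leaving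
    \<open>1 / R n\<close>.\<close>
  have high: "(deriv ^^ Suc M) W z = 0" if z: "z \<in> \<Omega>" for z
  proof -
    define A where "A = \<Omega> \<inter> ball 0 (norm z + 1)"
    have A: "open A" "z \<in> A" using \<Omega> z by (auto simp: A_def)
    have "(\<lambda>n. (deriv ^^ Suc M) (q n) z) \<longlonglongrightarrow> (deriv ^^ Suc M) W z"
      by (rule higher_deriv_complex_uniform_limit[OF ul[of "norm z + 1", folded A_def] qh[of "norm z + 1", folded A_def] _ A]) simp
    moreover have "(\<lambda>n. (deriv ^^ Suc M) (q n) z) \<longlonglongrightarrow> 0"
    proof (rule Lim_null_comparison)
      show "(\<lambda>n. fact (Suc M) * C * 4 ^ Suc M / R n) \<longlonglongrightarrow> 0"
        by (intro tendsto_divide_0[OF tendsto_const] filterlim_at_top_imp_at_infinity R_lim)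
      show "\<forall>\<^sub>F n in sequentially. norm ((deriv ^^ Suc M) (q n) z) \<le> fact (Suc M) * C * 4 ^ Suc M / R n"
        using R_big[of "4 * norm z"]
      proof eventually_elim
        case (elim n)
        have R1: "1 \<le> R n" using R_R0[of n] MC by linarith
        have in_half: "norm w \<le> R n / 2" if "w \<in> cball z (R n / 4)" for w
        proof -
          have "norm w \<le> norm z + dist z w" using norm_triangle_ineq2[of w z] by (simp add: dist_norm norm_minus_commute)
          then show ?thesis using that elim by simp
        qed
        have sub: "cball z (R n / 4) \<subseteq> ball 0 (R n)" using in_half R1 by force
        have "norm ((deriv ^^ Suc M) (q n) z) \<le> fact (Suc M) * (C * R n ^ M) / (R n / 4) ^ Suc M"
        proof (rule Cauchy_inequality)
          show "q n holomorphic_on ball z (R n / 4)" using sub by (intro holomorphic_on_subset[OF q(1)]) auto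
          show "continuous_on (cball z (R n / 4)) (q n)"
            by (rule holomorphic_on_imp_continuous_on[OF holomorphic_on_subset[OF q(1) sub]])
          show "norm (q n x) \<le> C * R n ^ M" if "norm (z - x) = R n / 4" for x
            by (rule q(2), rule in_half) (use that in \<open>simp add: dist_norm\<close>)
        qed (use R1 in auto)
        also have "\<dots> = fact (Suc M) * C * 4 ^ Suc M / R n"
          using R1 by (simp add: power_divide field_simps)
        finally show ?case .
      qed
    qed
    ultimately show ?thesis by (rule LIMSEQ_unique)
  qed
  define z0 where "z0 = complex_of_real c"
  have z0: "z0 \<in> \<Omega>" by (simp add: z0_def \<Omega>_def)
  define a where "a = (\<lambda>i. (deriv ^^ i) W z0 / fact i)"
  have W_poly: "W z = (\<Sum>i\<le>M. a i * (z - z0) ^ i)" if z: "z \<in> \<Omega>" for z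
  proof -
    \<comment> \<open>Taylor's formula on the convex half-plane, with remainder bound 0 because the
      next derivative vanishes identically.\<close>
    have "cmod ((deriv ^^ 0) W z - (\<Sum>i\<le>M. (deriv ^^ i) W z0 * (z - z0) ^ i / fact i)) \<le> 0 * cmod (z - z0) ^ Suc M / fact M"
    proof (rule complex_Taylor[OF \<Omega>(2) _ _ z0 z])
      fix i x assume x: "x \<in> \<Omega>"
      have "((deriv ^^ i) W has_field_derivative deriv ((deriv ^^ i) W) x) (at x)"
        by (rule holomorphic_derivI[OF holomorphic_higher_deriv[OF W_hol \<Omega>(1)] \<Omega>(1) x])
      then show "((deriv ^^ i) W has_field_derivative (deriv ^^ Suc i) W x) (at x within \<Omega>)"
        by (simp add: has_field_derivative_at_within)
    qed (use high in auto)
    then show ?thesis by (simp add: a_def)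
  qed
  have W_lim: "((\<lambda>x. W (z0 + of_real x)) \<longlongrightarrow> 0) at_top"
  proof -
    have "((\<lambda>x. W (of_real x)) \<longlongrightarrow> 0 + 0) at_top"
      unfolding W_def E_def by (intro tendsto_add lim pole_series_tendsto_0[OF summ c])
    moreover have "filterlim (\<lambda>x. c + x) at_top at_top"
      by (rule filterlim_tendsto_add_at_top[OF tendsto_const filterlim_ident])
    ultimately show ?thesis using filterlim_compose[of "\<lambda>x. W (of_real x)"] by (force simp: z0_def)
  qed
  have W_poly': "\<forall>\<^sub>F x in at_top. W (z0 + of_real x) = (\<Sum>i\<le>M. a i * of_real x ^ i)"
    using eventually_ge_at_top[of 0] by eventually_elim (subst W_poly, auto simp: z0_def \<Omega>_def)
  \<comment> \<open>A nonconstant polynomial is unbounded at infinity, against the limit of W along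
    the reals. The constant term is treated separately below.\<close>
  have a0: "a k = 0" if "k \<noteq> 0" "k \<le> M" for k
  proof (rule ccontr)
    assume "a k \<noteq> 0"
    then have "\<forall>\<^sub>F z in at_infinity. norm (\<Sum>i\<le>M. a i * z ^ i) \<ge> 1"
      using that by (intro polyfun_extremal) auto
    moreover have "filterlim (\<lambda>x::real. complex_of_real x) at_infinity at_top"
      by (intro filterlim_compose[OF filterlim_of_real_at_infinity] filterlim_at_top_imp_at_infinity filterlim_ident)
    ultimately have "\<forall>\<^sub>F x in at_top. norm (\<Sum>i\<le>M. a i * complex_of_real x ^ i) \<ge> 1"
      by (rule eventually_compose_filterlim)
    moreover have "\<forall>\<^sub>F x in at_top. norm (W (z0 + of_real x)) < 1"
      using tendstoD[OF W_lim, of 1] by simp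
    ultimately have "\<forall>\<^sub>F x::real in at_top. False"
      using W_poly' by eventually_elim auto
    then show False by simp
  qed
  have W_const: "W z = a 0" if "z \<in> \<Omega>" for z
  proof -
    have "W z = (\<Sum>i\<le>M. if i = 0 then a 0 else 0)"
      unfolding W_poly[OF that] by (rule sum.cong) (use a0 in auto)
    then show ?thesis by simp
  qed
  have "\<forall>\<^sub>F x in at_top. W (z0 + of_real x) = a 0"
    using eventually_ge_at_top[of 0] by eventually_elim (auto intro!: W_const simp: z0_def \<Omega>_def)
  then have "((\<lambda>x. W (z0 + of_real x)) \<longlongrightarrow> a 0) at_top" by (rule tendsto_eventually)
  then have "a 0 = 0" using W_lim by (rule tendsto_unique[OF trivial_limit_at_top_linorder])
  then have "W s = 0" using W_const[of s] s by (simp add: \<Omega>_def)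
  then show ?thesis by (simp add: W_def E_def add_eq_0_iff)
qed

text \<open>The terms with \<open>|\<rho>| \<le> r\<close> contribute at most pi times the divisor
  count after integration, while the others are uniformly small pointwise by the tail estimate. Each
  part is given half of \<open>\<eta> * T\<close>.\<close>

lemma mean_deriv_log_derivative:
  assumes summ: "weight summable_on UNIV" and ord: "nev_order g < \<infinity>"
    and c: "1 \<le> c" "\<And>z. z \<in> divisor \<Longrightarrow> Re z \<le> c - 2"
    and lim: "((\<lambda>x. deriv logderiv (of_real x)) \<longlongrightarrow> 0) at_top"
    and cont: "continuous_on {s. c \<le> Re s} (deriv logderiv)"
    and sparse: "\<And>A r0. 0 < A \<Longrightarrow> \<exists>r\<ge>r0. divisor_count r \<le> A * r"
    and x: "c \<le> x" and \<eta>: "0 < \<eta>"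
  shows "\<exists>T\<ge>T0. integral {0..T} (\<lambda>t. norm (deriv logderiv (Complex x t))) \<le> \<eta> * T"
proof -
  have "((\<lambda>Y. 16 * tail Y) \<longlongrightarrow> 16 * 0) at_top" by (intro tendsto_intros tail_tendsto_0 summ)
  then have "\<forall>\<^sub>F Y in at_top. 16 * tail Y < \<eta> / 2" using \<eta> by (intro order_tendstoD(2)) auto
  then obtain Y0 where Y0: "\<And>Y. Y0 \<le> Y \<Longrightarrow> 16 * tail Y < \<eta> / 2" by (auto simp: eventually_at_top_linorder)
  \<comment> \<open>With T = r/4, \<open>pi * A * r\<close> equals
    \<open>\<eta> / 2 * T\<close>.\<close>
  define A where "A = \<eta> / (8 * pi)"
  have "0 < A" using \<eta> by (simp add: A_def)
  then obtain r where r: "max Y0 (max (4 * x) (4 * T0)) \<le> r" "divisor_count r \<le> A * r" using sparse by blast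
  \<comment> \<open>Since x and t are both at most r/4, the segment stays in the disc of radius r/2,
    where the far terms obey the estimate with constant 4.\<close>
  define T where "T = r / 4"
  have r1: "Y0 \<le> r" "x \<le> T" "T0 \<le> T" "1 \<le> r" "0 \<le> T" using r c x by (auto simp: T_def)
  define h where "h = (\<lambda>t. \<Sum>\<rho>\<in>divisor \<inter> cball 0 r. \<bar>real_of_int (zorder g \<rho>)\<bar> * (1 / (norm (Complex x t - \<rho>))\<^sup>2))"
  have cC: "continuous_on S (\<lambda>t. Complex x t)" for S
    unfolding Complex_eq by (intro continuous_intros)
  have ne: "Complex x t \<noteq> \<rho>" if "\<rho> \<in> divisor" for t \<rho> using c(2)[OF that] x by auto
  have int\<rho>: "(\<lambda>t. 1 / (norm (Complex x t - \<rho>))\<^sup>2) integrable_on {0..T}" if "\<rho> \<in> divisor" for \<rho>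
    using ne[OF that] by (intro integrable_continuous_real continuous_intros cC) auto
  have int_h: "h integrable_on {0..T}"
    unfolding h_def by (intro integrable_sum finite_divisor integrable_on_mult_right int\<rho>) auto
  have "integral {0..T} (\<lambda>t. norm (deriv logderiv (Complex x t))) \<le> integral {0..T} (\<lambda>t. h t + \<eta> / 2)"
  proof (rule integral_le)
    show "(\<lambda>t. norm (deriv logderiv (Complex x t))) integrable_on {0..T}"
      by (intro integrable_continuous_real continuous_intros continuous_on_compose2[OF cont cC]) (use x in auto)
    show "(\<lambda>t. h t + \<eta> / 2) integrable_on {0..T}"
      by (intro integrable_add int_h) auto
    fix t assume t: "t \<in> {0..T}"
    define s where "s = Complex x t"
    have "norm s \<le> \<bar>x\<bar> + \<bar>t\<bar>" using cmod_le[of s] by (simp add: s_def)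
    then have sn: "norm s \<le> r / 2" using t r1 c x by (simp add: T_def)
    define E where "E = (\<Sum>\<^sub>\<infinity>\<rho>. of_int (zorder g \<rho>) / (s - \<rho>)\<^sup>2)"
    define E1 where "E1 = (\<Sum>\<rho>\<in>divisor \<inter> cball 0 r. of_int (zorder g \<rho>) / (s - \<rho>)\<^sup>2)"
    have "norm (E - E1) \<le> 4\<^sup>2 * tail r"
      unfolding E_def E1_def by (rule pole_series_split[OF summ]) (rule far_from_divisor[OF sn r1(4)])
    then have "norm (E - E1) \<le> \<eta> / 2" using Y0[OF r1(1)] by simp
    moreover have "norm E1 \<le> h t"
      unfolding E1_def h_def s_def[symmetric] by (rule order_trans[OF norm_sum]) (simp add: norm_divide norm_power)
    moreover have "deriv logderiv s = - E"
      unfolding E_def using x by (intro deriv_log_derivative_series[OF summ ord c lim]) (auto simp: s_def)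
    ultimately show "norm (deriv logderiv (Complex x t)) \<le> h t + \<eta> / 2"
      using norm_triangle_sub[of E E1] by (simp add: s_def)
  qed
  also have "\<dots> = integral {0..T} h + \<eta> / 2 * T"
    using r1 int_h by (subst integral_add) (auto simp: mult.commute)
  also have "integral {0..T} h + \<eta> / 2 * T \<le> \<eta> / 2 * T + \<eta> / 2 * T"
  proof (rule add_right_mono)
    have "integral {0..T} h = (\<Sum>\<rho>\<in>divisor \<inter> cball 0 r. integral {0..T} (\<lambda>t. \<bar>real_of_int (zorder g \<rho>)\<bar> * (1 / (norm (Complex x t - \<rho>))\<^sup>2)))"
      unfolding h_def by (intro integral_sum[OF finite_divisor] integrable_on_mult_right int\<rho>) simp
    also have "\<dots> = (\<Sum>\<rho>\<in>divisor \<inter> cball 0 r. \<bar>real_of_int (zorder g \<rho>)\<bar> * integral {0..T} (\<lambda>t. 1 / (norm (Complex x t - \<rho>))\<^sup>2))"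
      by (simp only: integral_mult_right)
    also have "\<dots> \<le> (\<Sum>\<rho>\<in>divisor \<inter> cball 0 r. \<bar>real_of_int (zorder g \<rho>)\<bar> * pi)"
      by (intro sum_mono mult_left_mono integral_inverse_square_bound r1) (use c(2) x in fastforce)+
    also have "\<dots> = divisor_count r * pi" by (simp add: divisor_count_def sum_distrib_right)
    also have "\<dots> \<le> A * r * pi" using r(2) by (intro mult_right_mono) auto
    also have "\<dots> = \<eta> / 2 * T" by (simp add: A_def T_def)
    finally show "integral {0..T} h \<le> \<eta> / 2 * T" .
  qed
  also have "\<eta> / 2 * T + \<eta> / 2 * T = \<eta> * T" by (simp add: field_simps)
  finally have "integral {0..T} (\<lambda>t. norm (deriv logderiv (Complex x t))) \<le> \<eta> * T" .
  then show ?thesis using r1 by blast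
qed

end

section \<open>General Dirichlet series\<close>

text \<open>Cauchy's inequality on unit discs: far to the right, f stays within e/2 of L on the
  whole disc. The filter makes the limits uniform in the imaginary part.\<close>

lemma deriv_tendsto_0_Re_at_top:
  assumes hol: "f holomorphic_on {s. a < Re s}" and lim: "filterlim f (nhds L) (filtercomap Re at_top)"
  shows "filterlim (deriv f) (nhds 0) (filtercomap Re at_top)"
proof (rule tendstoI)
  fix e :: real assume e: "0 < e"
  have "\<forall>\<^sub>F s in filtercomap Re at_top. dist (f s) L < e / 2"
    using e by (intro tendstoD[OF lim]) auto
  then obtain X where X: "\<And>s. X \<le> Re s \<Longrightarrow> dist (f s) L < e / 2"
    unfolding eventually_filtercomap_at_top_linorder by blast
  have "dist (deriv f s) 0 < e" if s: "max X a + 2 \<le> Re s" for s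
  proof -
    have near: "X \<le> Re w \<and> a < Re w" if "w \<in> cball s 1" for w
    proof -
      have "\<bar>Re s - Re w\<bar> \<le> 1" using that abs_Re_le_cmod[of "s - w"] by (simp add: dist_norm)
      then show ?thesis using s by auto
    qed
    have "norm ((deriv ^^ 1) f s) \<le> fact 1 * (e / 2) / 1 ^ 1"
    proof (rule Cauchy_higher_deriv_bound)
      show "f holomorphic_on ball s 1" using near by (intro holomorphic_on_subset[OF hol]) auto
      show "continuous_on (cball s 1) f"
        using near by (intro continuous_on_subset[OF holomorphic_on_imp_continuous_on[OF hol]]) auto
      show "f w \<in> ball L (e / 2)" if "w \<in> ball s 1" for w
        using X[of w] near[of w] that by (simp add: dist_commute)
    qed auto
    then show ?thesis using e by simp
  qed
  then show "\<forall>\<^sub>F s in filtercomap Re at_top. dist (deriv f s) 0 < e"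
    unfolding eventually_filtercomap_at_top_linorder by blast
qed

text \<open>Uniform convergence gives one partial sum within e/3 on the entire half-plane, and a
  common near period of its finitely many frequencies moves that sum by at most e/3. Restricting to
  a strip bounds the exponentials, whatever the signs of the frequencies.\<close>

lemma Dirichlet_series_near_periods:
  fixes a :: "nat \<Rightarrow> complex" and lam :: "nat \<Rightarrow> real"
  assumes unif: "uniformly_convergent_on {s. b < Re s} (\<lambda>N s. \<Sum>n<N. a n * exp (of_real (lam n) * s))"
    and g: "\<forall>s. b < Re s \<longrightarrow> g s = (\<Sum>n. a n * exp (of_real (lam n) * s))"
    and \<alpha>: "b < \<alpha>" and e: "0 < e"
  shows "\<exists>L>0. \<forall>y. \<exists>\<tau>\<in>{y..y+L}. \<forall>s. \<alpha> \<le> Re s \<and> Re s \<le> \<beta> \<longrightarrow> norm (g (s + \<i> * of_real \<tau>) - g s) \<le> e"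
proof -
  define P where "P = (\<lambda>N s. \<Sum>n<N. a n * exp (of_real (lam n) * s))"
  have ul: "uniform_limit {s. b < Re s} P (\<lambda>s. lim (\<lambda>N. P N s)) sequentially"
    using unif unfolding P_def uniformly_convergent_uniform_limit_iff .
  have "\<forall>\<^sub>F N in sequentially. \<forall>s\<in>{s. b < Re s}. dist (P N s) (lim (\<lambda>N. P N s)) < e / 3"
    using uniform_limitD[OF ul, of "e / 3"] e by simp
  then obtain N where N: "\<And>s. b < Re s \<Longrightarrow> dist (P N s) (lim (\<lambda>N. P N s)) < e / 3"
    by (auto simp: eventually_sequentially)
  have PN: "norm (P N s - g s) \<le> e / 3" if "b < Re s" for s
    using N[OF that] g that by (simp add: P_def suminf_eq_lim dist_norm less_imp_le)
  \<comment> \<open>A bound for the sum of the moduli of the N terms on the strip; the summand 1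
    keeps the later division by B legitimate.\<close>
  define B where "B = 1 + (\<Sum>n<N. norm (a n) * exp (\<bar>lam n\<bar> * (\<bar>\<alpha>\<bar> + \<bar>\<beta>\<bar>)))"
  have B1: "B - 1 = (\<Sum>n<N. norm (a n) * exp (\<bar>lam n\<bar> * (\<bar>\<alpha>\<bar> + \<bar>\<beta>\<bar>)))" by (simp add: B_def)
  have B: "1 \<le> B" unfolding B_def by (simp add: sum_nonneg)
  have "0 < e / (3 * B)" using e B by simp
  then obtain L where L: "0 < L" "\<And>y. \<exists>\<tau>\<in>{y..y+L}. \<forall>n<N. norm (cis (lam n * \<tau>) - 1) \<le> e / (3 * B)"
    using relatively_dense_near_periods by metis
  have "\<exists>\<tau>\<in>{y..y+L}. \<forall>s. \<alpha> \<le> Re s \<and> Re s \<le> \<beta> \<longrightarrow> norm (g (s + \<i> * of_real \<tau>) - g s) \<le> e" for y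
  proof -
    obtain \<tau> where \<tau>: "\<tau> \<in> {y..y+L}" "\<And>n. n < N \<Longrightarrow> norm (cis (lam n * \<tau>) - 1) \<le> e / (3 * B)"
      using L(2)[of y] by blast
    have "norm (g (s + \<i> * of_real \<tau>) - g s) \<le> e" if s: "\<alpha> \<le> Re s" "Re s \<le> \<beta>" for s
    proof -
      have "P N (s + \<i> * of_real \<tau>) - P N s = (\<Sum>n<N. a n * exp (of_real (lam n) * s) * (cis (lam n * \<tau>) - 1))"
        by (simp add: P_def sum_subtractf[symmetric] cis_conv_exp algebra_simps exp_add)
      also have "norm \<dots> \<le> (\<Sum>n<N. norm (a n) * exp (\<bar>lam n\<bar> * (\<bar>\<alpha>\<bar> + \<bar>\<beta>\<bar>)) * (e / (3 * B)))"
      proof (rule sum_norm_le)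
        fix n assume n: "n \<in> {..<N}"
        have "lam n * Re s \<le> \<bar>lam n\<bar> * \<bar>Re s\<bar>" using abs_ge_self[of "lam n * Re s"] by (simp add: abs_mult)
        also have "\<dots> \<le> \<bar>lam n\<bar> * (\<bar>\<alpha>\<bar> + \<bar>\<beta>\<bar>)" using s by (intro mult_left_mono) auto
        finally have "norm (exp (of_real (lam n) * s)) \<le> exp (\<bar>lam n\<bar> * (\<bar>\<alpha>\<bar> + \<bar>\<beta>\<bar>))" by simp
        then show "norm (a n * exp (of_real (lam n) * s) * (cis (lam n * \<tau>) - 1))
            \<le> norm (a n) * exp (\<bar>lam n\<bar> * (\<bar>\<alpha>\<bar> + \<bar>\<beta>\<bar>)) * (e / (3 * B))"
          unfolding norm_mult using \<tau>(2)[of n] n by (intro mult_mono mult_left_mono) auto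
      qed
      also have "\<dots> = (B - 1) * (e / (3 * B))"
        by (subst B1) (simp only: sum_distrib_right)
      also have "\<dots> \<le> B * (e / (3 * B))" using e B by (intro mult_right_mono) auto
      also have "\<dots> = e / 3" using B by simp
      finally have 1: "norm (P N (s + \<i> * of_real \<tau>) - P N s) \<le> e / 3" .
      have 2: "norm (P N s - g s) \<le> e / 3" "norm (g (s + \<i> * of_real \<tau>) - P N (s + \<i> * of_real \<tau>)) \<le> e / 3"
        using PN[of s] PN[of "s + \<i> * of_real \<tau>"] s \<alpha> by (auto simp: norm_minus_commute)
      have eq: "g (s + \<i> * of_real \<tau>) - g s = (g (s + \<i> * of_real \<tau>) - P N (s + \<i> * of_real \<tau>))
          + (P N (s + \<i> * of_real \<tau>) - P N s) + (P N s - g s)" by simp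
      have "norm (g (s + \<i> * of_real \<tau>) - g s) \<le> e / 3 + e / 3 + e / 3"
        unfolding eq by (intro norm_triangle_mono 1 2)
      then show ?thesis by simp
    qed
    then show ?thesis using \<tau>(1) by blast
  qed
  then show ?thesis using L(1) by blast
qed

section \<open>From a finite counting integral to summable weights\<close>

context nonconstant_meromorphic
begin

text \<open>A point \<rho> outside the unit disc adds its multiplicity m to the count for all
  \<open>t \<ge> |\<rho>|\<close>. On \<open>[|\<rho>|, 2 |\<rho>|]\<close> the integrand thereby
  gains at least \<open>m / (8 |\<rho>|^3)\<close>, and the length |\<rho>| makes this
  \<open>m / (8 |\<rho>|^2)\<close>. The points of the unit disc are finitely many.\<close>

lemma weight_summable:
  assumes fin: "(\<integral>\<^sup>+ t \<in> {1..}. ennreal (divisor_count t / t ^ 3) \<partial>lborel) \<noteq> \<infinity>"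
  shows "weight summable_on UNIV"
proof (rule nonneg_bdd_above_summable_on)
  define I where "I = enn2real (\<integral>\<^sup>+ t \<in> {1..}. ennreal (divisor_count t / t ^ 3) \<partial>lborel)"
  have I: "(\<integral>\<^sup>+ t \<in> {1..}. ennreal (divisor_count t / t ^ 3) \<partial>lborel) = ennreal I"
    using fin by (simp add: I_def less_top[symmetric])
  have I0: "0 \<le> I" by (simp add: I_def)
  show "bdd_above (sum weight ` {F. F \<subseteq> UNIV \<and> finite F})"
  proof (rule bdd_aboveI2)
    fix X :: "complex set" assume "X \<in> {F. F \<subseteq> UNIV \<and> finite F}"
    then have X: "finite X" by simp
    define Y where "Y = {\<rho> \<in> X \<inter> divisor. 1 < norm \<rho>}"
    have fY: "finite Y" using X by (simp add: Y_def)
    define m where "m = (\<lambda>\<rho>. \<bar>real_of_int (zorder g \<rho>)\<bar>)"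
    have m0: "0 \<le> m \<rho>" for \<rho> by (simp add: m_def)
    have "(\<Sum>\<rho>\<in>Y. ennreal (m \<rho> / (8 * (norm \<rho>)\<^sup>2)))
        = (\<Sum>\<rho>\<in>Y. \<integral>\<^sup>+ t. ennreal (m \<rho> / (8 * norm \<rho> ^ 3)) * indicator {norm \<rho>..2 * norm \<rho>} t \<partial>lborel)"
    proof (rule sum.cong)
      fix \<rho> assume "\<rho> \<in> Y"
      then have r: "1 < norm \<rho>" by (simp add: Y_def)
      have "(\<integral>\<^sup>+ t. ennreal (m \<rho> / (8 * norm \<rho> ^ 3)) * indicator {norm \<rho>..2 * norm \<rho>} t \<partial>lborel)
          = ennreal (m \<rho> / (8 * norm \<rho> ^ 3)) * ennreal (norm \<rho>)"
        by (subst nn_integral_cmult_indicator) (auto simp: emeasure_lborel_Icc)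
      also have "\<dots> = ennreal (m \<rho> / (8 * (norm \<rho>)\<^sup>2))"
        using r m0[of \<rho>] by (simp add: ennreal_mult'[symmetric] power2_eq_square power3_eq_cube)
      finally show "ennreal (m \<rho> / (8 * (norm \<rho>)\<^sup>2)) =
         (\<integral>\<^sup>+ t. ennreal (m \<rho> / (8 * norm \<rho> ^ 3)) * indicator {norm \<rho>..2 * norm \<rho>} t \<partial>lborel)" ..
    qed simp
    also have "\<dots> = (\<integral>\<^sup>+ t. (\<Sum>\<rho>\<in>Y. ennreal (m \<rho> / (8 * norm \<rho> ^ 3)) * indicator {norm \<rho>..2 * norm \<rho>} t) \<partial>lborel)"
      by (rule nn_integral_sum[symmetric]) simp
    also have "\<dots> \<le> (\<integral>\<^sup>+ t \<in> {1..}. ennreal (divisor_count t / t ^ 3) \<partial>lborel)"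
    proof (rule nn_integral_mono)
      fix t :: real
      show "(\<Sum>\<rho>\<in>Y. ennreal (m \<rho> / (8 * norm \<rho> ^ 3)) * indicator {norm \<rho>..2 * norm \<rho>} t)
         \<le> ennreal (divisor_count t / t ^ 3) * indicator {1..} t"
      proof (cases "1 \<le> t")
        case True
        have "(\<Sum>\<rho>\<in>Y. ennreal (m \<rho> / (8 * norm \<rho> ^ 3)) * indicator {norm \<rho>..2 * norm \<rho>} t)
            \<le> (\<Sum>\<rho>\<in>Y. ennreal (if norm \<rho> \<le> t then m \<rho> / t ^ 3 else 0))"
        proof (rule sum_mono)
          fix \<rho> assume "\<rho> \<in> Y"
          show "ennreal (m \<rho> / (8 * norm \<rho> ^ 3)) * indicator {norm \<rho>..2 * norm \<rho>} t
              \<le> ennreal (if norm \<rho> \<le> t then m \<rho> / t ^ 3 else 0)"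
          proof (cases "t \<in> {norm \<rho>..2 * norm \<rho>}")
            case t: True
            then have "t ^ 3 \<le> (2 * norm \<rho>) ^ 3" using True by (intro power_mono) auto
            then have "m \<rho> / (8 * norm \<rho> ^ 3) \<le> m \<rho> / t ^ 3"
              using True m0[of \<rho>] by (intro divide_left_mono) (auto simp: power_mult_distrib intro!: mult_pos_pos)
            then show ?thesis using t by (simp add: ennreal_leI)
          qed simp
        qed
        also have "\<dots> = ennreal (\<Sum>\<rho>\<in>Y. if norm \<rho> \<le> t then m \<rho> / t ^ 3 else 0)"
          by (rule sum_ennreal) (use m0 True in auto)
        also have "\<dots> \<le> ennreal (divisor_count t / t ^ 3)"
        proof (rule ennreal_leI)
          have "(\<Sum>\<rho>\<in>Y. if norm \<rho> \<le> t then m \<rho> / t ^ 3 else 0) = (\<Sum>\<rho>\<in>{\<rho>\<in>Y. norm \<rho> \<le> t}. m \<rho> / t ^ 3)"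
            using fY by (intro sum.inter_filter[symmetric])
          also have "\<dots> \<le> (\<Sum>\<rho>\<in>divisor \<inter> cball 0 t. m \<rho> / t ^ 3)"
            by (rule sum_mono2[OF finite_divisor]) (use m0 True in \<open>auto simp: Y_def\<close>)
          also have "\<dots> = divisor_count t / t ^ 3" by (simp add: divisor_count_def m_def sum_divide_distrib)
          finally show "(\<Sum>\<rho>\<in>Y. if norm \<rho> \<le> t then m \<rho> / t ^ 3 else 0) \<le> divisor_count t / t ^ 3" .
        qed
        finally show ?thesis using True by simp
      next
        case False
        have "ennreal (m \<rho> / (8 * norm \<rho> ^ 3)) * indicator {norm \<rho>..2 * norm \<rho>} t = 0" if "\<rho> \<in> Y" for \<rho>
          using that False by (auto simp: Y_def indicator_def)
        then show ?thesis by (subst sum.neutral) auto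
      qed
    qed
    also have "\<dots> = ennreal I" by (rule I)
    also have "(\<Sum>\<rho>\<in>Y. ennreal (m \<rho> / (8 * (norm \<rho>)\<^sup>2))) = ennreal (\<Sum>\<rho>\<in>Y. m \<rho> / (8 * (norm \<rho>)\<^sup>2))"
      by (rule sum_ennreal) (simp add: m0)
    finally have le: "(\<Sum>\<rho>\<in>Y. m \<rho> / (8 * (norm \<rho>)\<^sup>2)) \<le> I" using I0 by simp
    have "sum weight X = sum weight ((X \<inter> divisor \<inter> cball 0 1) \<union> Y)"
      by (rule sum.mono_neutral_right) (use X weight_outside in \<open>auto simp: Y_def\<close>)
    also have "\<dots> = sum weight (X \<inter> divisor \<inter> cball 0 1) + sum weight Y"
      by (rule sum.union_disjoint) (use X in \<open>auto simp: Y_def\<close>)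
    also have "\<dots> \<le> divisor_count 1 + 8 * I"
    proof (rule add_mono)
      have "sum weight (X \<inter> divisor \<inter> cball 0 1) \<le> sum m (divisor \<inter> cball 0 1)"
      proof (rule sum_mono2[OF finite_divisor, THEN order_trans[rotated]])
        show "sum weight (X \<inter> divisor \<inter> cball 0 1) \<le> sum m (X \<inter> divisor \<inter> cball 0 1)"
        proof (rule sum_mono)
          fix \<rho> :: complex
          have "1 \<le> (1 + norm \<rho>)\<^sup>2" using norm_ge_zero[of \<rho>] by (simp add: one_le_power)
          then have "m \<rho> / (1 + norm \<rho>)\<^sup>2 \<le> m \<rho> / 1" using m0[of \<rho>] by (intro divide_left_mono) linarith+
          then show "weight \<rho> \<le> m \<rho>" by (simp add: weight_def m_def)
        qed
      qed (auto simp: m0)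
      then show "sum weight (X \<inter> divisor \<inter> cball 0 1) \<le> divisor_count 1" by (simp add: divisor_count_def m_def)
      have "sum weight Y \<le> (\<Sum>\<rho>\<in>Y. 8 * (m \<rho> / (8 * (norm \<rho>)\<^sup>2)))"
      proof (rule sum_mono)
        fix \<rho> assume "\<rho> \<in> Y"
        then have r: "1 < norm \<rho>" by (simp add: Y_def)
        have "(norm \<rho>)\<^sup>2 \<le> (1 + norm \<rho>)\<^sup>2" by (intro power_mono) auto
        then have "m \<rho> / (1 + norm \<rho>)\<^sup>2 \<le> m \<rho> / (norm \<rho>)\<^sup>2"
          using r m0[of \<rho>] by (intro divide_left_mono mult_pos_pos) auto
        then show "weight \<rho> \<le> 8 * (m \<rho> / (8 * (norm \<rho>)\<^sup>2))" by (simp add: weight_def m_def)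
      qed
      also have "\<dots> = 8 * (\<Sum>\<rho>\<in>Y. m \<rho> / (8 * (norm \<rho>)\<^sup>2))" by (simp only: sum_distrib_left)
      also have "\<dots> \<le> 8 * I" using le by simp
      finally show "sum weight Y \<le> 8 * I" .
    qed
    finally show "sum weight X \<le> divisor_count 1 + 8 * I" .
  qed
qed (simp add: weight_nonneg)

end

section \<open>Contradiction from the failure of both alternatives\<close>

theorem theorem1p2:
  fixes a :: "nat \<Rightarrow> complex" and lam :: "nat \<Rightarrow> real" and b :: real
    and g :: "complex \<Rightarrow> complex" and L :: complex
  assumes unif: "uniformly_convergent_on {s. b < Re s}
                   (\<lambda>N s. \<Sum>n<N. a n * exp (of_real (lam n) * s))"
    and mero: "g nicely_meromorphic_on UNIV"
    and cont: "\<forall>s. b < Re s \<longrightarrow> g s = (\<Sum>n. a n * exp (of_real (lam n) * s))"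
    and nonconst: "\<not> (\<exists>c. \<forall>s. g s = c)"
    and fin_order: "nev_order g < \<infinity>"
    and lim: "filterlim g (nhds L) (filtercomap Re at_top)"
    and L_nz: "L \<noteq> 0"
  shows "(\<exists>A>0. eventually (\<lambda>r. (zero_count g r + pole_count g r) / r > A) at_top)
       \<or> (\<exists>r0>0. (\<integral>\<^sup>+ t \<in> {r0..}. ennreal ((zero_count g t + pole_count g t) / t ^ 3) \<partial>lborel) = \<infinity>)"
proof (rule ccontr)
  interpret nonconstant_meromorphic g
    by unfold_locales (fact mero, fact nonconst)
  assume neg: "\<not> ?thesis"
  have neg1: "\<exists>\<^sub>F r in at_top. divisor_count r / r \<le> A" if "0 < A" for A
  proof -
    have "\<not> eventually (\<lambda>r. (zero_count g r + pole_count g r) / r > A) at_top" using neg that by blast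
    then show ?thesis by (simp add: zero_count_plus_pole_count frequently_def not_le)
  qed
  have neg2: "(\<integral>\<^sup>+ t \<in> {1..}. ennreal (divisor_count t / t ^ 3) \<partial>lborel) \<noteq> \<infinity>"
    using neg zero_less_one unfolding zero_count_plus_pole_count by blast
  have summ: "weight summable_on UNIV" by (rule weight_summable[OF neg2])
  have sparse: "\<exists>r\<ge>r0. divisor_count r \<le> A * r" if A: "0 < A" for A r0
  proof -
    have "\<exists>\<^sub>F r in at_top. divisor_count r / r \<le> A \<and> max r0 1 \<le> r"
      by (rule frequently_eventually_frequently[OF neg1[OF A] eventually_ge_at_top])
    then obtain r where "divisor_count r / r \<le> A" "max r0 1 \<le> r" by (auto dest: frequently_ex)
    then show ?thesis by (intro exI[of _ r]) (auto simp: divide_le_eq)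
  qed
  define l where "l = norm L"
  have l: "0 < l" using L_nz by (simp add: l_def)
  have "\<forall>\<^sub>F s in filtercomap Re at_top. dist (g s) L < l / 2"
    using l by (intro tendstoD[OF lim]) auto
  then obtain X where X: "\<And>s. X \<le> Re s \<Longrightarrow> dist (g s) L < l / 2"
    unfolding eventually_filtercomap_at_top_linorder by blast
  \<comment> \<open>\<open>X + 3\<close> makes the half-plane H, which begins at c - 2, lie where g
    is close to L; \<open>b + 2\<close> keeps the strip of width 1 around any
    \<open>x \<ge> c\<close> inside the region of uniform convergence.\<close>
  define c where "c = max 1 (max (b + 2) (X + 3))"
  have c1: "1 \<le> c" "b + 2 \<le> c" "X + 3 \<le> c" by (auto simp: c_def)
  define H where "H = {s. c - 2 < Re s}"
  have H: "open H" unfolding H_def by (rule open_halfspace_Re_gt)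
  have gL: "g s \<in> ball L (l / 2)" if "s \<in> H" for s
    using X[of s] that c1 by (simp add: H_def dist_commute)
  have g_bd: "l / 2 \<le> norm (g s)" "norm (g s) \<le> 3 * l / 2" if "s \<in> H" for s
    using gL[OF that] norm_triangle_ineq2[of L "g s"] norm_triangle_ineq2[of "g s" L]
    by (auto simp: dist_norm l_def norm_minus_commute)
  have g_nz: "g s \<noteq> 0" if "s \<in> H" for s using g_bd(1)[OF that] l by auto
  \<comment> \<open>The value at a pole is 0 by convention, so a nonzero value rules out a
    pole.\<close>
  have g_an: "g analytic_on {s}" if "s \<in> H" for s
    using nicely_meromorphic_on_imp_analytic_at[OF mero] is_pole_zero_at_nicely_mero[OF mero] g_nz[OF that] by blast
  have HD: "s \<notin> divisor" if "s \<in> H" for s using not_in_divisor g_an g_nz that by blast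
  have c2: "Re z \<le> c - 2" if "z \<in> divisor" for z using HD[of z] that by (force simp: H_def)
  have g_hol: "g holomorphic_on H"
    using g_an analytic_on_analytic_at analytic_imp_holomorphic by blast
  have dg_hol: "deriv g holomorphic_on H" by (rule holomorphic_deriv[OF g_hol H])
  have F_hol: "logderiv holomorphic_on H"
    unfolding logderiv_def by (intro holomorphic_intros g_hol dg_hol g_nz)
  have dF_hol: "deriv logderiv holomorphic_on H" by (rule holomorphic_deriv[OF F_hol H])
  have dF_cont: "continuous_on {s. c \<le> Re s} (deriv logderiv)"
    by (rule continuous_on_subset[OF holomorphic_on_imp_continuous_on[OF dF_hol]]) (auto simp: H_def)
  have dg_lim: "filterlim (deriv g) (nhds 0) (filtercomap Re at_top)"
    by (rule deriv_tendsto_0_Re_at_top[OF g_hol[unfolded H_def] lim])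
  have F_lim: "filterlim logderiv (nhds 0) (filtercomap Re at_top)"
    using tendsto_divide[OF dg_lim lim L_nz] unfolding logderiv_def[abs_def] by simp
  have dF_lim: "filterlim (deriv logderiv) (nhds 0) (filtercomap Re at_top)"
    by (rule deriv_tendsto_0_Re_at_top[OF F_hol[unfolded H_def] F_lim])
  have real_lim: "filterlim complex_of_real (filtercomap Re at_top) at_top"
    by (simp add: filterlim_filtercomap_iff o_def filterlim_ident)
  have dF_real: "((\<lambda>x. deriv logderiv (of_real x)) \<longlongrightarrow> 0) at_top"
    by (rule filterlim_compose[OF dF_lim real_lim])
  \<comment> \<open>Cauchy's inequality with radius 1/2 and oscillation l/2 about L.\<close>
  have dg_bd: "norm (deriv g s) \<le> l" if "c - 1 \<le> Re s" for s
  proof -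
    have near: "w \<in> H" if "w \<in> cball s (1/2)" for w
    proof -
      have "\<bar>Re s - Re w\<bar> \<le> 1/2" using that abs_Re_le_cmod[of "s - w"] by (simp add: dist_norm)
      then show ?thesis using \<open>c - 1 \<le> Re s\<close> unfolding H_def mem_Collect_eq by linarith
    qed
    have "norm ((deriv ^^ 1) g s) \<le> fact 1 * (l / 2) / (1 / 2) ^ 1"
    proof (rule Cauchy_higher_deriv_bound)
      show "g holomorphic_on ball s (1/2)" using near by (intro holomorphic_on_subset[OF g_hol]) auto
      show "continuous_on (cball s (1/2)) g"
        using near by (intro continuous_on_subset[OF holomorphic_on_imp_continuous_on[OF g_hol]]) auto
      show "g w \<in> ball L (l / 2)" if "w \<in> ball s (1/2)" for w
        using gL near that by auto
    qed auto
    then show ?thesis by simp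
  qed
  have dF_0: "deriv logderiv (Complex x t) = 0" if x: "c \<le> x" for x t
  proof (rule almost_periodic_mean_zero[of "\<lambda>t. deriv logderiv (Complex x t)"])
    show "continuous_on UNIV (\<lambda>t. deriv logderiv (Complex x t))"
      unfolding Complex_eq using x by (intro continuous_on_compose2[OF dF_cont] continuous_intros) auto
    show "\<exists>T\<ge>T0. integral {0..T} (\<lambda>t. norm (deriv logderiv (Complex x t))) \<le> \<eta> * T" if "0 < \<eta>" for \<eta> T0
      by (rule mean_deriv_log_derivative[OF summ fin_order c1(1) c2 dF_real dF_cont sparse x that])
    fix e :: real assume e: "0 < e"
    \<comment> \<open>The loss along the chain: \<delta> for g on the strip
      \<open>x \<plusminus> 1\<close>, 2 \<delta> for its derivative on
      \<open>x \<plusminus> 1/2\<close>, \<open>16 \<delta> / l\<close> for the quotient there, and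
      twice that for the derivative of the quotient on the line itself.\<close>
    define \<delta> where "\<delta> = e * l / 32"
    have \<delta>: "0 < \<delta>" using e l by (simp add: \<delta>_def)
    have "b < x - 1" using c1 x by linarith
    then obtain L' where L': "0 < L'" "\<And>y. \<exists>\<tau>\<in>{y..y+L'}. \<forall>s. x - 1 \<le> Re s \<and> Re s \<le> x + 1 \<longrightarrow> norm (g (s + \<i> * of_real \<tau>) - g s) \<le> \<delta>"
      using Dirichlet_series_near_periods[OF unif cont _ \<delta>, of "x - 1" "x + 1"] by blast
    have "\<exists>\<tau>\<in>{y..y+L'}. \<forall>t. norm (deriv logderiv (Complex x (t + \<tau>)) - deriv logderiv (Complex x t)) \<le> e" for y
    proof -
      obtain \<tau> where \<tau>: "\<tau> \<in> {y..y+L'}"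
        "\<And>s. x - 1 \<le> Re s \<Longrightarrow> Re s \<le> x + 1 \<Longrightarrow> norm (g (s + \<i> * of_real \<tau>) - g s) \<le> \<delta>"
        using L'(2)[of y] by blast
      have dg: "norm (deriv g (s + \<i> * of_real \<tau>) - deriv g s) \<le> \<delta> / (1/2)"
        if "x - 1/2 \<le> Re s" "Re s \<le> x + 1/2" for s
        by (rule deriv_near_period[OF g_hol H, of "x - 1/2" "1/2" "x + 1/2"])
           (use that x \<tau>(2) in \<open>auto simp: H_def\<close>)
      have dF: "norm (logderiv (s + \<i> * of_real \<tau>) - logderiv s) \<le> 16 * \<delta> / l"
        if s: "x - 1/2 \<le> Re s" "Re s \<le> x + 1/2" for s
      proof -
        define w where "w = s + \<i> * of_real \<tau>"
        have inH: "s \<in> H" "w \<in> H" using s x by (auto simp: H_def w_def)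
        have "logderiv w - logderiv s = ((deriv g w - deriv g s) * g s - deriv g s * (g w - g s)) / (g w * g s)"
          using g_nz[OF inH(1)] g_nz[OF inH(2)] by (simp add: logderiv_def field_simps)
        then have "norm (logderiv w - logderiv s) = norm ((deriv g w - deriv g s) * g s - deriv g s * (g w - g s)) / (norm (g w) * norm (g s))"
          by (simp add: norm_divide norm_mult)
        also have "\<dots> \<le> (2 * \<delta> * (3 * l / 2) + l * \<delta>) / (l / 2 * (l / 2))"
        proof (rule frac_le)
          have "norm ((deriv g w - deriv g s) * g s) \<le> 2 * \<delta> * (3 * l / 2)"
            unfolding norm_mult using dg[OF s] g_bd(2)[OF inH(1)] \<delta> l by (intro mult_mono) (auto simp: w_def)
          moreover have "norm (deriv g s * (g w - g s)) \<le> l * \<delta>"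
            unfolding norm_mult using dg_bd[of s] s x \<tau>(2)[of s] \<delta> l by (intro mult_mono) (auto simp: w_def)
          ultimately show "norm ((deriv g w - deriv g s) * g s - deriv g s * (g w - g s)) \<le> 2 * \<delta> * (3 * l / 2) + l * \<delta>"
            by (rule order_trans[OF norm_triangle_ineq4 add_mono])
          show "l / 2 * (l / 2) \<le> norm (g w) * norm (g s)"
            using g_bd(1)[OF inH(1)] g_bd(1)[OF inH(2)] l by (intro mult_mono) auto
        qed (use l \<delta> in auto)
        also have "\<dots> = 16 * \<delta> / l" using l by (simp add: field_simps)
        finally show ?thesis by (simp add: w_def)
      qed
      have "norm (deriv logderiv (Complex x (t + \<tau>)) - deriv logderiv (Complex x t)) \<le> e" for t
      proof -
        have "norm (deriv logderiv (Complex x t + \<i> * of_real \<tau>) - deriv logderiv (Complex x t)) \<le> (16 * \<delta> / l) / (1/2)"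
          by (rule deriv_near_period[OF F_hol H, of x "1/2" x])
             (use x dF in \<open>auto simp: H_def\<close>)
        also have "\<dots> = e" using l by (simp add: \<delta>_def)
        also have "Complex x t + \<i> * of_real \<tau> = Complex x (t + \<tau>)" by (simp add: complex_eq_iff)
        finally show ?thesis .
      qed
      then show ?thesis using \<tau>(1) by blast
    qed
    then show "\<exists>L>0. \<forall>y. \<exists>\<tau>\<in>{y..y+L}. \<forall>t. norm (deriv logderiv (Complex x (t + \<tau>)) - deriv logderiv (Complex x t)) \<le> e"
      using L'(1) by blast
  qed
  define H' where "H' = {s. c < Re s}"
  have H': "open H'" "convex H'" "H' \<subseteq> H" "of_real (c + 1) \<in> H'"
    unfolding H'_def H_def by (auto simp: open_halfspace_Re_gt convex_halfspace_Re_gt)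
  have "(logderiv has_field_derivative 0) (at s within H')" if "s \<in> H'" for s
  proof -
    have "(logderiv has_field_derivative deriv logderiv s) (at s within H')"
      using holomorphic_derivI[OF F_hol H] H'(3) that by blast
    moreover have "deriv logderiv s = 0" using dF_0[of "Re s" "Im s"] that by (simp add: H'_def)
    ultimately show ?thesis by simp
  qed
  then have "\<exists>\<kappa>. \<forall>s\<in>H'. logderiv s = \<kappa>" by (rule has_field_derivative_zero_constant[OF H'(2)])
  then obtain \<kappa> where \<kappa>: "\<And>s. s \<in> H' \<Longrightarrow> logderiv s = \<kappa>" by blast
  have "\<forall>\<^sub>F x in at_top. logderiv (of_real x) = \<kappa>"
    using eventually_gt_at_top[of c] by eventually_elim (auto intro!: \<kappa> simp: H'_def)
  then have "((\<lambda>x. logderiv (of_real x)) \<longlongrightarrow> \<kappa>) at_top" by (rule tendsto_eventually)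
  then have "\<kappa> = 0"
    using filterlim_compose[OF F_lim real_lim] by (rule tendsto_unique[OF trivial_limit_at_top_linorder])
  have "(g has_field_derivative 0) (at s within H')" if "s \<in> H'" for s
  proof -
    have "(g has_field_derivative deriv g s) (at s within H')"
      using holomorphic_derivI[OF g_hol H] H'(3) that by blast
    moreover have "deriv g s = 0" using \<kappa>[OF that] \<open>\<kappa> = 0\<close> g_nz H'(3) that by (auto simp: logderiv_def)
    ultimately show ?thesis by simp
  qed
  then have "g constant_on H'"
    unfolding constant_on_def by (rule has_field_derivative_zero_constant[OF H'(2)])
  \<comment> \<open>Identity principle; nice meromorphy lets the constant extend to every point, so
    no poles or exceptional values remain.\<close>
  then have "g constant_on UNIV"
    using H' by (intro constant_on_extend_nicely_meromorphic_on[OF mero]) auto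
  then show False using nonconst by (auto simp: constant_on_def)
qed

end
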